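(* Let $m\in\left(-\frac12,1\right]$. Then for any $\gamma\in\mathbb{R}$ the boundary value problem $$f'''+(m+2)ff''-(2m+1)f'^2=0 \text{ on } [0,\infty),\qquad f(0)=-\gamma,\quad f''(0)=-1,\quad f'(\infty)=0$$ admits one and only one solution, and this solution is concave.
   Context: Here $f'(\infty):=\lim_{t\to\infty}f'(t)$. A solution is a three times differentiable function $f:[0,\infty)\to\mathbb{R}$ satisfying the differential equation on $[0,\infty)$ together with all three boundary conditions; $f'(0)$ is not prescribed. *)

theory Defs
  imports "HOL-Analysis.Analysis"
begin

(* Functions on the half-line are represented by total functions whose values outside {0..}
   are irrelevant. The functions f1, f2, f3 are the successive derivatives of f on {0..},
   one-sided at 0. *)
definition bvp_solution :: "real \<Rightarrow> real \<Rightarrow> (real \<Rightarrow> real) \<Rightarrow> bool" where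
  "bvp_solution m \<gamma> f \<longleftrightarrow>
     (\<exists>f1 f2 f3 :: real \<Rightarrow> real.
        (\<forall>t\<in>{0..}. (f has_real_derivative f1 t) (at t within {0..}) \<and>
                  (f1 has_real_derivative f2 t) (at t within {0..}) \<and>
                  (f2 has_real_derivative f3 t) (at t within {0..})) \<and>
        (\<forall>t\<in>{0..}. f3 t + (m + 2) * f t * f2 t - (2 * m + 1) * (f1 t)\<^sup>2 = 0) \<and>
        f 0 = - \<gamma> \<and> f2 0 = -1 \<and> (f1 \<longlongrightarrow> 0) at_top)"

end

theory Submission
  imports Defs
begin

text \<open>
  If the second derivative of a solution vanishes somewhere, then from there on the solution is
  convex, positive and decreasing. Such a tail cannot exist when \<open>m \<le> 1\<close>: it would stay on one side of
  the explicit exponential solutions of the case \<open>m = 1\<close>, and on that side no orbit reaches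
  \<open>f' = 0\<close> only at infinity. So every solution is concave with nonnegative slope.
  For two concave solutions with different initial slopes the gap between the slopes
  never shrinks, which is incompatible with both tending to 0.
  Existence is by shooting in the initial slope: the slopes for which \<open>f'\<close> becomes negative
  first and those for which \<open>f''\<close> becomes positive first form disjoint open sets, and an
  intermediate slope gives a concave solution for all times, whose derivative tends to 0.
\<close>

section \<open>Differential inequalities\<close>

text \<open>The comparison curve for convex tails comes from eliminating a parameter: along
  \<open>f = a + b exp (- 3 a t)\<close> one has \<open>- f'' / f' = 3 a\<close> and
  \<open>- f' = 3 a (f - a)\<close>, so with \<open>p = - f'\<close> and
  \<open>r = - f'' / f'\<close> these orbits lie on \<open>r^2 - 3 f r + 3 p = 0\<close>. A tail
  starts at \<open>r = 0\<close> with \<open>p > 0\<close>, on the positive side of the curve, and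
  \<open>1 - m \<ge> 0\<close> is the sign that keeps it there. The signs of \<open>f'\<close> and
  \<open>f''\<close> are settled before two solutions are compared, because these signs make the
  coupling in the difference system nonnegative. For existence, a quadratic vector field does not
  come with global orbits, whereas shooting wants every slope to have an orbit for all times that
  depends continuously on the slope. The equation is therefore modified outside a box that grows
  with time and that is not left while the orbit is concave with nonnegative slope.\<close>

lemma deriv_lower_bound:
  fixes y y' :: "real \<Rightarrow> real"
  assumes "s \<le> t" "{s..t} \<subseteq> S"
    and d: "\<And>x. x \<in> {s..t} \<Longrightarrow> (y has_real_derivative y' x) (at x within S)"
    and c: "\<And>x. x \<in> {s..t} \<Longrightarrow> c \<le> y' x"
  shows "y s + c * (t - s) \<le> y t"
proof -
  have "\<exists>x\<in>{s..t}. y t - y s = y' x * (t - s)"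
  proof (rule mvt_very_simple[OF \<open>s \<le> t\<close>])
    fix x assume "s \<le> x" "x \<le> t"
    then show "(y has_derivative (*) (y' x)) (at x within {s..t})"
      by (auto simp flip: has_field_derivative_def intro: DERIV_subset[OF d assms(2)])
  qed
  then obtain x where "x \<in> {s..t}" "y t - y s = y' x * (t - s)" by blast
  moreover have "c * (t - s) \<le> y' x * (t - s)"
    using c[OF \<open>x \<in> {s..t}\<close>] \<open>s \<le> t\<close> by (simp add: mult_right_mono)
  ultimately show ?thesis by linarith
qed

text \<open>Integrating factor: for an antiderivative \<open>K\<close> of \<open>k\<close>, the
  function \<open>y * exp (- K)\<close> is nondecreasing. The coefficient \<open>k\<close> may
  depend on the orbit itself, so this also serves as Gronwall's inequality for nonlinear
  systems.\<close>

lemma linear_diff_ineq: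
  fixes y y' k :: "real \<Rightarrow> real"
  assumes st: "s \<le> t" "{s..t} \<subseteq> S"
    and d: "\<And>x. x \<in> {s..t} \<Longrightarrow> (y has_real_derivative y' x) (at x within S)"
    and le: "\<And>x. x \<in> {s..t} \<Longrightarrow> k x * y x \<le> y' x"
    and k: "continuous_on {s..t} k"
  shows "0 \<le> y s \<Longrightarrow> 0 \<le> y t" "0 < y s \<Longrightarrow> 0 < y t"
proof -
  obtain K where K: "\<And>x. x \<in> {s..t} \<Longrightarrow> (K has_real_derivative k x) (at x within {s..t})"
    using antiderivative_continuous[OF k] has_real_derivative_iff_has_vector_derivative by metis
  have dy: "(y has_real_derivative y' x) (at x within {s..t})" if "x \<in> {s..t}" for x
    using d[OF that] st(2) by (rule DERIV_subset)
  have "y s * exp (- K s) + 0 * (t - s) \<le> y t * exp (- K t)"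
  proof (rule deriv_lower_bound[OF st(1) order_refl])
    fix x assume x: "x \<in> {s..t}"
    show "((\<lambda>x. y x * exp (- K x)) has_real_derivative (y' x - k x * y x) * exp (- K x)) (at x within {s..t})"
      by (rule derivative_eq_intros dy[OF x] K[OF x] refl | simp add: algebra_simps)+
    show "0 \<le> (y' x - k x * y x) * exp (- K x)" using le[OF x] by simp
  qed
  then have "y s * exp (- K s) * exp (K t) \<le> y t * exp (- K t) * exp (K t)"
    by (intro mult_right_mono) auto
  then have "exp (K t - K s) * y s \<le> y t"
    by (simp add: mult.assoc flip: exp_add) (simp add: mult.commute)
  moreover have "0 \<le> exp (K t - K s) * y s" if "0 \<le> y s" using that by simp
  moreover have "0 < exp (K t - K s) * y s" if "0 < y s" using that by simp
  ultimately show "0 \<le> y s \<Longrightarrow> 0 \<le> y t" "0 < y s \<Longrightarrow> 0 < y t" by linarith+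
qed

lemma first_zero:
  fixes y :: "real \<Rightarrow> real"
  assumes cont: "continuous_on {s..t} y" and st: "s \<le> t" "0 < y s" "y t \<le> 0"
  obtains T where "s < T" "T \<le> t" "y T = 0" "\<And>x. s \<le> x \<Longrightarrow> x < T \<Longrightarrow> 0 < y x"
proof -
  let ?S = "{x \<in> {s..t}. y x \<le> 0}"
  have "closed ?S"
    using continuous_on_closed_Collect_le[OF cont continuous_on_const] by simp
  moreover have "bounded ?S"
    by (rule bounded_subset[of "{s..t}"]) auto
  ultimately have "compact ?S"
    using compact_eq_bounded_closed by blast
  then obtain T where T: "T \<in> ?S" "\<And>x. x \<in> ?S \<Longrightarrow> T \<le> x"
    using compact_attains_inf[of ?S] st by auto
  have pos: "0 < y x" if "s \<le> x" "x < T" for x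
    using T(2)[of x] T(1) that by force
  have "continuous_on {s..T} y" using cont T(1) by (auto elim: continuous_on_subset)
  then obtain x where "s \<le> x" "x \<le> T" "y x = 0"
    using IVT2'[of y T 0 s] T(1) st by auto
  then have "y T = 0" using pos[of x] by (cases "x = T") auto
  moreover have "s < T" using T(1) \<open>y T = 0\<close> st by (cases "s = T") auto
  ultimately show thesis using that T(1) pos by auto
qed

section \<open>Convex tails\<close>

text \<open>Here \<open>p = - f'\<close> and \<open>r = - f'' / f'\<close>. The function \<open>D\<close> below vanishes along the explicit
  solutions \<open>f = a + b * exp (- 3 * a * t)\<close> of the case \<open>m = 1\<close>; it satisfies a linear differential
  inequality for every \<open>m \<le> 1\<close>, hence stays positive. Since \<open>r\<close> is bounded by a multiple of \<open>f\<close>,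
  positivity of \<open>D\<close> excludes both \<open>r \<ge> 3/2 * f\<close> (then \<open>r\<close> would grow linearly) and \<open>r < 3/2 * f\<close>
  (then \<open>p\<close> eventually dominates \<open>f\<^sup>2\<close>, so \<open>r + (m + 1/2) * f\<close> increases although it tends to 0).\<close>

lemma no_convex_tail:
  fixes m s :: real and f p r :: "real \<Rightarrow> real"
  assumes m: "- 1/2 < m" "m \<le> 1"
    and df: "\<And>t. t \<ge> s \<Longrightarrow> (f has_real_derivative - p t) (at t within {s..})"
    and dp: "\<And>t. t \<ge> s \<Longrightarrow> (p has_real_derivative - r t * p t) (at t within {s..})"
    and dr: "\<And>t. t \<ge> s \<Longrightarrow> (r has_real_derivative (r t)\<^sup>2 - (m + 2) * f t * r t + (2 * m + 1) * p t) (at t within {s..})"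
    and f: "\<And>t. t \<ge> s \<Longrightarrow> 0 < f t" and p: "\<And>t. t \<ge> s \<Longrightarrow> 0 < p t"
    and r: "\<And>t. t \<ge> s \<Longrightarrow> 0 \<le> r t" "\<And>t. t \<ge> s \<Longrightarrow> r t \<le> (m + 2) * f t"
    and rs: "r s = 0" and plim: "(p \<longlongrightarrow> 0) at_top"
  shows False
proof -
  define D where "D = (\<lambda>t. (r t)\<^sup>2 - 3 * f t * r t + 3 * p t)"
  define c where "c = 4/3 * (1 - m)"
  have c: "0 \<le> c" using m by (simp add: c_def)
  have cont: "continuous_on {s..} f" "continuous_on {s..} p" "continuous_on {s..} r"
    by (rule DERIV_continuous_on, erule df[OF atLeast_iff[THEN iffD1]] dp[OF atLeast_iff[THEN iffD1]] dr[OF atLeast_iff[THEN iffD1]])+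
  have sub: "{t1..t} \<subseteq> {s..}" if "t1 \<ge> s" for t1 t using that by auto
  \<comment> \<open>The equations give \<open>D' = (2 r - 3 f) r'\<close>. Writing \<open>r'\<close>
    as \<open>(2 m + 1) / 3 * D + 2/3 * (1 - m) * r * (r - 3/2 * f)\<close> turns the second summand
    into \<open>c * r\<close> times a square, nonnegative for \<open>m \<le> 1\<close>.\<close>
  have dD: "(D has_real_derivative ((2 - c) * r t - (2 * m + 1) * f t) * D t + c * r t * (r t - 3/2 * f t)\<^sup>2) (at t within {s..})"
    if t: "t \<ge> s" for t
    unfolding D_def
    by (rule derivative_eq_intros df[OF t] dr[OF t] dp[OF t] refl)+ (simp add: c_def field_simps power2_eq_square)
  have Dpos: "0 < D t" if t: "t \<ge> s" for t
  proof (rule linear_diff_ineq(2)[OF t sub[OF order_refl] dD])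
    show "continuous_on {s..t} (\<lambda>t. (2 - c) * r t - (2 * m + 1) * f t)"
      by (intro continuous_intros continuous_on_subset[OF cont(1)] continuous_on_subset[OF cont(3)]) auto
  qed (use p[of s] rs c r in \<open>simp_all add: D_def\<close>)
  have r': "(r t)\<^sup>2 - (m + 2) * f t * r t + (2 * m + 1) * p t = (2 * m + 1) / 3 * D t + 2/3 * (1 - m) * r t * (r t - 3/2 * f t)" for t
    unfolding D_def by (simp add: field_simps power2_eq_square)
  have fmono: "f t \<le> f t1" if "s \<le> t1" "t1 \<le> t" for t1 t
  proof -
    have "- f t1 + 0 * (t - t1) \<le> - f t"
    proof (rule deriv_lower_bound[OF that(2) sub[OF that(1)]])
      fix x assume "x \<in> {t1..t}"
      then have x: "x \<ge> s" using that by auto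
      show "((\<lambda>t. - f t) has_real_derivative p x) (at x within {s..})"
        using DERIV_minus[OF df[OF x]] by simp
      show "0 \<le> p x" using p[OF x] by simp
    qed
    then show ?thesis by simp
  qed
  \<comment> \<open>The factor of \<open>D\<close> in its derivative is
    \<open>(2 - c) * (r - 3/2 * f)\<close>. If it is nonnegative once, it stays so; then
    \<open>D\<close> cannot decrease, and \<open>r'\<close> keeps a positive lower bound.\<close>
  have A: "r t1 < 3/2 * f t1" if t1: "t1 \<ge> s" for t1
  proof (rule ccontr)
    assume "\<not> ?thesis"
    then have y0: "0 \<le> r t1 - 3/2 * f t1" by simp
    have y: "0 \<le> r t - 3/2 * f t" if t: "t \<ge> t1" for t
    proof (rule linear_diff_ineq(1)[where y="\<lambda>t. r t - 3/2 * f t" and k="\<lambda>x. 2/3 * (1 - m) * r x", OF t sub[OF t1] _ _ _ y0])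
        show "continuous_on {t1..t} (\<lambda>x. 2/3 * (1 - m) * r x)"
          by (intro continuous_intros continuous_on_subset[OF cont(3) sub[OF t1]])
      next
        fix x assume "x \<in> {t1..t}"
        then have x: "x \<ge> s" using t1 by simp
        show "((\<lambda>x. r x - 3/2 * f x) has_real_derivative (2 * m + 1) / 3 * D x + 2/3 * (1 - m) * r x * (r x - 3/2 * f x) + 3/2 * p x) (at x within {s..})"
        proof -
          have "((\<lambda>x. r x - 3/2 * f x) has_real_derivative ((2 * m + 1) / 3 * D x + 2/3 * (1 - m) * r x * (r x - 3/2 * f x)) - 3/2 * (- p x)) (at x within {s..})"
            by (intro DERIV_diff DERIV_cmult df[OF x] dr[OF x, unfolded r'])
          then show ?thesis by simp
        qed
        show "2/3 * (1 - m) * r x * (r x - 3/2 * f x) \<le> (2 * m + 1) / 3 * D x + 2/3 * (1 - m) * r x * (r x - 3/2 * f x) + 3/2 * p x"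
          using Dpos[OF x] p[OF x] m by simp
    qed
    have D1: "D t1 \<le> D t" if t: "t \<ge> t1" for t
    proof -
      have "D t1 + 0 * (t - t1) \<le> D t"
      proof (rule deriv_lower_bound[OF t sub[OF t1]])
        fix x assume "x \<in> {t1..t}"
        then have x: "x \<ge> s" "x \<ge> t1" using t1 by auto
        show "(D has_real_derivative ((2 - c) * r x - (2 * m + 1) * f x) * D x + c * r x * (r x - 3/2 * f x)\<^sup>2) (at x within {s..})"
          by (rule dD[OF x(1)])
        have "(2 - c) * (3/2 * f x) \<le> (2 - c) * r x"
          using y[OF x(2)] m by (intro mult_left_mono) (auto simp: c_def)
        moreover have "(2 - c) * (3/2 * f x) = (2 * m + 1) * f x" by (simp add: c_def field_simps)
        ultimately have "0 \<le> (2 - c) * r x - (2 * m + 1) * f x" by linarith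
        then show "0 \<le> ((2 - c) * r x - (2 * m + 1) * f x) * D x + c * r x * (r x - 3/2 * f x)\<^sup>2"
          using Dpos[OF x(1)] c r(1)[OF x(1)] by simp
      qed
      then show ?thesis by simp
    qed
    define e where "e = (2 * m + 1) / 3 * D t1"
    have e: "e > 0" using Dpos[OF t1] m by (simp add: e_def)
    \<comment> \<open>By this time growth at rate \<open>e\<close> exceeds the upper bound
      \<open>(m + 2) * f s\<close> of \<open>r\<close>.\<close>
    define t where "t = t1 + (m + 2) * f s / e + 1"
    have t: "t \<ge> t1" using e m f[of s] by (simp add: t_def)
    have "r t1 + e * (t - t1) \<le> r t"
    proof (rule deriv_lower_bound[OF t sub[OF t1]])
      fix x assume "x \<in> {t1..t}"
      then have x: "x \<ge> s" "x \<ge> t1" using t1 by auto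
      show "(r has_real_derivative (2 * m + 1) / 3 * D x + 2/3 * (1 - m) * r x * (r x - 3/2 * f x)) (at x within {s..})"
        using dr[OF x(1)] unfolding r' .
      have "e \<le> (2 * m + 1) / 3 * D x"
        unfolding e_def using D1[OF x(2)] m by (intro mult_left_mono) auto
      moreover have "0 \<le> 2/3 * (1 - m) * r x * (r x - 3/2 * f x)"
        using m r(1)[OF x(1)] y[OF x(2)] by simp
      ultimately show "e \<le> (2 * m + 1) / 3 * D x + 2/3 * (1 - m) * r x * (r x - 3/2 * f x)" by linarith
    qed
    moreover have "e * (t - t1) = (m + 2) * f s + e" using e by (simp add: t_def field_simps)
    moreover have "r t \<le> (m + 2) * f t" "f t \<le> f s" using r(2)[of t] fmono[of s t] t t1 by simp_all
    moreover have "(m + 2) * f t \<le> (m + 2) * f s" using fmono[of s t] t t1 m by (intro mult_left_mono) auto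
    ultimately show False using e r(1)[OF t1] by argo
  qed
  \<comment> \<open>In terms of \<open>f\<close>, the quantity \<open>p * (r - f)\<close> is
    \<open>f'' + f * f'\<close>. From \<open>D > 0\<close> and \<open>r < 3/2 * f\<close> follows
    \<open>2 * p \<ge> f * r\<close>, so it is nondecreasing; being at most a constant times
    \<open>p\<close>, it is never positive.\<close>
  have rf: "r t \<le> f t" if t: "t \<ge> s" for t
  proof (rule ccontr)
    assume "\<not> ?thesis"
    then have g: "0 < p t * (r t - f t)" using p[OF t] by simp
    have mono: "p t * (r t - f t) \<le> p x * (r x - f x)" if x: "x \<ge> t" for x
    proof -
      have "p t * (r t - f t) + 0 * (x - t) \<le> p x * (r x - f x)"
      proof (rule deriv_lower_bound[OF x sub[OF t]])
        fix z assume "z \<in> {t..x}"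
        then have z: "z \<ge> s" using t by auto
        show "((\<lambda>z. p z * (r z - f z)) has_real_derivative (m + 1) * p z * (2 * p z - f z * r z)) (at z within {s..})"
          by (rule derivative_eq_intros df[OF z] dr[OF z] dp[OF z] refl)+ (simp add: algebra_simps power2_eq_square)
        have "0 \<le> r z * (3/2 * f z - r z)" using r(1)[OF z] A[OF z] by simp
        then have "0 \<le> 2 * p z - f z * r z" using Dpos[OF z] unfolding D_def by (simp add: algebra_simps power2_eq_square)
        then show "0 \<le> (m + 1) * p z * (2 * p z - f z * r z)" using p[OF z] m by simp
      qed
      then show ?thesis by simp
    qed
    have "p t * (r t - f t) \<le> p x * ((m + 2) * f s)" if x: "x \<ge> t" for x
    proof -
      have x': "x \<ge> s" using x t by simp
      have "(m + 2) * f x \<le> (m + 2) * f s" using fmono[OF _ x'] m by (intro mult_left_mono) auto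
      then have "r x - f x \<le> (m + 2) * f s" using r(2)[OF x'] f[OF x'] by linarith
      then have "p x * (r x - f x) \<le> p x * ((m + 2) * f s)"
        using p[OF x'] by (intro mult_left_mono) auto
      then show ?thesis using mono[OF x] by linarith
    qed
    then have "p t * (r t - f t) \<le> 0 * ((m + 2) * f s)"
      by (intro tendsto_lowerbound[OF tendsto_mult[OF plim tendsto_const]])
         (auto simp: eventually_at_top_linorder)
    then show False using g by simp
  qed
  \<comment> \<open>With \<open>r \<le> f\<close>, positivity of \<open>D\<close> gives
    \<open>3 * p \<ge> 2 * f * r\<close>, which makes \<open>p^2 / f^3\<close> nondecreasing. So
    \<open>p\<close> is at least a multiple of \<open>f\<close> to the power 3/2: \<open>f\<close>
    tends to 0 with \<open>p\<close>, and as 3/2 < 2, \<open>p\<close> eventually exceeds any fixed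
    multiple of \<open>f^2\<close>.\<close>
  define Y where "Y = (p s)\<^sup>2 / (f s)^3"
  have Y: "Y > 0" using p[of s] f[of s] by (simp add: Y_def)
  have pf: "Y * (f t)^3 \<le> (p t)\<^sup>2" if t: "t \<ge> s" for t
  proof -
    have "(p s)\<^sup>2 / (f s)^3 + 0 * (t - s) \<le> (p t)\<^sup>2 / (f t)^3"
    proof (rule deriv_lower_bound[OF t sub[OF order_refl]])
      fix x assume "x \<in> {s..t}"
      then have x: "x \<ge> s" by simp
      show "((\<lambda>x. (p x)\<^sup>2 / (f x)^3) has_real_derivative (p x)\<^sup>2 / (f x)^4 * (3 * p x - 2 * f x * r x)) (at x within {s..})"
        using f[OF x] by (auto intro!: derivative_eq_intros df[OF x] dp[OF x] simp: field_simps power2_eq_square eval_nat_numeral)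
      have "0 \<le> r x * (f x - r x)" using r(1)[OF x] rf[OF x] by simp
      then have "0 \<le> 3 * p x - 2 * f x * r x" using Dpos[OF x] unfolding D_def by (simp add: algebra_simps power2_eq_square)
      then show "0 \<le> (p x)\<^sup>2 / (f x)^4 * (3 * p x - 2 * f x * r x)" by simp
    qed
    then show ?thesis using f[OF t] by (simp add: Y_def field_simps)
  qed
  have flim: "\<exists>T\<ge>s. \<forall>t\<ge>T. f t < e" if e: "e > 0" for e
  proof -
    have "((\<lambda>t. (p t)\<^sup>2) \<longlongrightarrow> 0\<^sup>2) at_top" by (intro tendsto_intros plim)
    moreover have "0\<^sup>2 < Y * e^3" using Y e by simp
    ultimately have "eventually (\<lambda>t. (p t)\<^sup>2 < Y * e^3) at_top" by (rule order_tendstoD(2))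
    then obtain T where T: "\<And>t. t \<ge> T \<Longrightarrow> (p t)\<^sup>2 < Y * e^3" unfolding eventually_at_top_linorder by blast
    have "f t < e" if "t \<ge> max s T" for t
    proof -
      have "Y * (f t)^3 < Y * e^3" using pf[of t] T[of t] that by auto
      then have "(f t)^3 < e^3" using Y by simp
      then show ?thesis using e power_less_imp_less_base[of "f t" 3 e] by simp
    qed
    then show ?thesis by (intro exI[of _ "max s T"]) auto
  qed
  \<comment> \<open>Solves \<open>(m + 1/2) * a = m + 2\<close>, so that
    \<open>(m + 1/2) * p\<close> absorbs \<open>(m + 2) * f * r\<close> in the derivative of
    \<open>r + (m + 1/2) * f\<close>.\<close>
  define a where "a = 2 * (m + 2) / (2 * m + 1)"
  have a: "a > 0" using m by (simp add: a_def)
  obtain T where T: "T \<ge> s" "\<And>t. t \<ge> T \<Longrightarrow> f t < Y / a\<^sup>2" using flim[of "Y / a\<^sup>2"] Y a by auto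
  have pa: "a * (f t)\<^sup>2 \<le> p t" if t: "t \<ge> T" for t
  proof -
    have "f t * a\<^sup>2 \<le> Y" using T(2)[OF t] a by (simp add: field_simps)
    then have "f t * a\<^sup>2 * (f t)^3 \<le> Y * (f t)^3" using f[of t] t T(1) by (intro mult_right_mono) auto
    also have "\<dots> \<le> (p t)\<^sup>2" using pf t T(1) by simp
    finally have "(a * (f t)\<^sup>2)\<^sup>2 \<le> (p t)\<^sup>2" by (simp add: eval_nat_numeral algebra_simps)
    then show ?thesis using p[of t] t T(1) by (auto intro: power2_le_imp_le)
  qed
  have mono: "r T + (m + 1/2) * f T \<le> r t + (m + 1/2) * f t" if t: "t \<ge> T" for t
  proof -
    have "r T + (m + 1/2) * f T + 0 * (t - T) \<le> r t + (m + 1/2) * f t"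
    proof (rule deriv_lower_bound[OF t sub[OF T(1)]])
      fix x assume "x \<in> {T..t}"
      then have x: "x \<ge> s" "x \<ge> T" using T by auto
      show "((\<lambda>x. r x + (m + 1/2) * f x) has_real_derivative (r x)\<^sup>2 - (m + 2) * f x * r x + (m + 1/2) * p x) (at x within {s..})"
        by (rule derivative_eq_intros df[OF x(1)] dr[OF x(1)] refl)+ (simp add: field_simps)
      have "(m + 2) * f x * r x \<le> (m + 2) * f x * f x" using m rf[OF x(1)] f[OF x(1)] by (intro mult_left_mono) auto
      also have "\<dots> = (m + 1/2) * (a * (f x)\<^sup>2)" using m by (simp add: a_def field_simps power2_eq_square)
      also have "\<dots> \<le> (m + 1/2) * p x" using pa[OF x(2)] m by (intro mult_left_mono) auto
      finally show "0 \<le> (r x)\<^sup>2 - (m + 2) * f x * r x + (m + 1/2) * p x" using zero_le_power2[of "r x"] by linarith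
    qed
    then show ?thesis by simp
  qed
  define d where "d = r T + (m + 1/2) * f T"
  have d: "d > 0" using r(1)[OF T(1)] f[OF T(1)] m by (simp add: d_def add_nonneg_pos)
  obtain T' where T': "T' \<ge> s" "\<And>t. t \<ge> T' \<Longrightarrow> f t < d / (m + 3/2)" using flim[of "d / (m + 3/2)"] d m by auto
  have "d \<le> r (max T T') + (m + 1/2) * f (max T T')" using mono[of "max T T'"] by (simp add: d_def)
  also have "\<dots> \<le> (m + 3/2) * f (max T T')" using rf[of "max T T'"] T by (simp add: algebra_simps)
  also have "\<dots> < d" using T'(2)[of "max T T'"] m by (simp add: field_simps)
  finally show False by simp
qed

section \<open>Concavity and uniqueness\<close>

text \<open>The derivative of \<open>u^2 + q^2\<close> is bounded below by a continuous multiple of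
  \<open>u^2 + q^2\<close> itself, with \<open>f\<close> and \<open>q\<close> treated as known
  coefficients. The interval is finite because shooting applies this where the original equation is
  known only up to some time.\<close>

lemma flow_not_both_zero:
  fixes f u q :: "real \<Rightarrow> real"
  assumes m: "- 1/2 < m" and t: "t \<ge> 0" and f: "continuous_on {0..t} f"
    and du: "\<And>x. x \<in> {0..t} \<Longrightarrow> (u has_real_derivative q x) (at x within {0..})"
    and dq: "\<And>x. x \<in> {0..t} \<Longrightarrow> (q has_real_derivative (2 * m + 1) * (u x)\<^sup>2 - (m + 2) * f x * q x) (at x within {0..})"
    and init: "0 < (u 0)\<^sup>2 + (q 0)\<^sup>2"
  shows "0 < (u t)\<^sup>2 + (q t)\<^sup>2"
proof (rule linear_diff_ineq(2)[where y="\<lambda>t. (u t)\<^sup>2 + (q t)\<^sup>2" and S="{0..}", OF t])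
  have q: "continuous_on {0..t} q"
    by (rule DERIV_continuous_on) (rule DERIV_subset[OF dq], auto)
  show "continuous_on {0..t} (\<lambda>x. - (1 + 2 * (m + 2) * \<bar>f x\<bar> + 2 * (2 * m + 1) * \<bar>q x\<bar>))"
    by (intro continuous_intros f q)
next
  fix x assume x: "x \<in> {0..t}"
  let ?d = "2 * u x * q x + 2 * q x * ((2 * m + 1) * (u x)\<^sup>2 - (m + 2) * f x * q x)"
  show "((\<lambda>t. (u t)\<^sup>2 + (q t)\<^sup>2) has_real_derivative ?d) (at x within {0..})"
    by (rule derivative_eq_intros du[OF x] dq[OF x] refl)+ simp
  have "0 \<le> (u x + q x)\<^sup>2" "0 \<le> (2 * m + 1) * (u x)\<^sup>2 * (\<bar>q x\<bar> + q x)" "0 \<le> (m + 2) * (q x)\<^sup>2 * (\<bar>f x\<bar> - f x)"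
      "0 \<le> (m + 2) * (u x)\<^sup>2 * \<bar>f x\<bar>" "0 \<le> (2 * m + 1) * (q x)\<^sup>2 * \<bar>q x\<bar>"
    using m by simp_all
  then show "- (1 + 2 * (m + 2) * \<bar>f x\<bar> + 2 * (2 * m + 1) * \<bar>q x\<bar>) * ((u x)\<^sup>2 + (q x)\<^sup>2) \<le> ?d"
    by (simp add: algebra_simps power2_eq_square)
qed (use init in auto)

text \<open>\<open>u\<close> and \<open>q\<close> are \<open>f'\<close> and \<open>f''\<close>, and
  the third derivative is eliminated through the equation. \<open>f 0\<close> stays free and
  \<open>f''\<close> is only negative at 0, which suffices for the sign analysis.\<close>

locale similarity_flow =
  fixes m :: real and f u q :: "real \<Rightarrow> real"
  assumes m: "- 1/2 < m" "m \<le> 1"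
    and df: "\<And>t. t \<ge> 0 \<Longrightarrow> (f has_real_derivative u t) (at t within {0..})"
    and du: "\<And>t. t \<ge> 0 \<Longrightarrow> (u has_real_derivative q t) (at t within {0..})"
    and dq: "\<And>t. t \<ge> 0 \<Longrightarrow> (q has_real_derivative (2 * m + 1) * (u t)\<^sup>2 - (m + 2) * f t * q t) (at t within {0..})"
    and q_init: "q 0 < 0" and u_lim: "(u \<longlongrightarrow> 0) at_top"
begin

section \<open>Signs of the derivatives and concavity\<close>

lemma continuous: "continuous_on {0..} f" "continuous_on {0..} u" "continuous_on {0..} q"
  by (rule DERIV_continuous_on, erule df[OF atLeast_iff[THEN iffD1]] du[OF atLeast_iff[THEN iffD1]] dq[OF atLeast_iff[THEN iffD1]])+

lemma not_both_zero:
  assumes "t \<ge> 0"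
  shows "0 < (u t)\<^sup>2 + (q t)\<^sup>2"
proof (rule flow_not_both_zero[OF m(1) assms])
  show "continuous_on {0..t} f" by (rule continuous_on_subset[OF continuous(1)]) auto
qed (use q_init du dq in \<open>auto simp: add_nonneg_pos\<close>)

lemma q_nonneg:
  assumes "0 \<le> s" "s \<le> t" "0 \<le> q s"
  shows "0 \<le> q t"
proof (rule linear_diff_ineq(1)[where y=q and S="{0..}" and k="\<lambda>x. - (m + 2) * f x", OF assms(2)])
  show "continuous_on {s..t} (\<lambda>x. - (m + 2) * f x)"
    using assms by (intro continuous_intros continuous_on_subset[OF continuous(1)]) auto
  show "(q has_real_derivative (2 * m + 1) * (u x)\<^sup>2 - (m + 2) * f x * q x) (at x within {0..})" if "x \<in> {s..t}" for x
    using dq[of x] that assms by simp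
  show "- (m + 2) * f x * q x \<le> (2 * m + 1) * (u x)\<^sup>2 - (m + 2) * f x * q x" for x
    using mult_nonneg_nonneg[of "2 * m + 1" "(u x)\<^sup>2"] m by (simp only: mult_minus_left, simp)
qed (use assms in auto)

text \<open>From a zero of \<open>q\<close> onwards the orbit would satisfy every hypothesis of
  \<open>no_convex_tail\<close>, with \<open>p = - u\<close> and \<open>r = - q / u\<close>.\<close>

lemma q_neg:
  assumes "t \<ge> 0"
  shows "q t < 0"
proof (rule ccontr)
  assume "\<not> ?thesis"
  then obtain s where s: "s \<ge> 0" "q s = 0"
    using IVT'[of q 0 0 t] assms q_init continuous_on_subset[OF continuous(3), of "{0..t}"] by auto
  have sub: "{x..y} \<subseteq> {0..}" if "s \<le> x" for x y :: real using that s by auto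
  have q: "0 \<le> q x" if "x \<ge> s" for x using q_nonneg[of s x] s that by simp
  have umono: "u x \<le> u y" if "s \<le> x" "x \<le> y" for x y
    using deriv_lower_bound[OF that(2) sub[OF that(1)] du, of 0] that q s by simp
  have u_le: "u x \<le> 0" if "x \<ge> s" for x
    using that by (intro tendsto_lowerbound[OF u_lim]) (auto simp: eventually_at_top_linorder intro!: exI[of _ x] umono)
  have u: "u x < 0" if x: "x \<ge> s" for x
  proof (rule ccontr)
    assume "\<not> ?thesis"
    then have u0: "u y = 0" if "y \<ge> x" for y using umono[OF x that] u_le[of y] x that by simp
    have "at (x + 1) within {0..} = at (x + 1)"
      by (rule at_within_open_subset[of _ "{0<..}"]) (use x s in auto)
    then have "DERIV u (x + 1) :> q (x + 1)" using du[of "x + 1"] x s by simp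
    then have "q (x + 1) = 0" by (rule DERIV_local_const[of _ _ _ 1]) (auto simp: u0 abs_if split: if_splits)
    then show False using not_both_zero[of "x + 1"] u0[of "x + 1"] x s by simp
  qed
  \<comment> \<open>A persistent bound \<open>q \<ge> c\<close> would lift \<open>u\<close> to 0 by
    the time \<open>T - u T / c\<close>, although \<open>u\<close> stays negative.\<close>
  have no_growth: False if T: "T \<ge> s" and c: "c > 0" and "\<And>x. x \<ge> T \<Longrightarrow> c \<le> q x" for T c
  proof -
    have le: "T \<le> T - u T / c" using u[OF T] c by (simp add: divide_le_0_iff)
    have "u T + c * ((T - u T / c) - T) \<le> u (T - u T / c)"
      using that s by (intro deriv_lower_bound[OF le sub[OF T] du]) auto
    moreover have "u (T - u T / c) < 0" using T le by (intro u) simp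
    ultimately show False using c by simp
  qed
  have fmono: "f y \<le> f x" if "s \<le> x" "x \<le> y" for x y
  proof -
    have "- f x + 0 * (y - x) \<le> - f y"
    proof (rule deriv_lower_bound[OF that(2) sub[OF that(1)]])
      fix z assume "z \<in> {x..y}"
      then have z: "z \<ge> s" using that by auto
      show "((\<lambda>z. - f z) has_real_derivative - u z) (at z within {0..})" using z s by (intro DERIV_minus df) auto
      show "0 \<le> - u z" using u[OF z] by simp
    qed
    then show ?thesis by simp
  qed
  \<comment> \<open>A nonpositive \<open>f\<close> would stay nonpositive, so
    \<open>- (m + 2) * f * q \<ge> 0\<close>; then \<open>q\<close> gains a fixed positive amount
    from \<open>(2 * m + 1) * u^2\<close> during one unit of time and never loses it.\<close>
  have f: "0 < f x" if x: "x \<ge> s" for x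
  proof (rule ccontr)
    assume "\<not> ?thesis"
    then have fneg: "f y \<le> 0" if "y \<ge> x" for y using fmono[OF x that] by simp
    let ?c = "(2 * m + 1) * (u (x + 1))\<^sup>2"
    have c: "?c > 0" using m u[of "x + 1"] x by simp
    have fq: "(m + 2) * f y * q y \<le> 0" if "y \<ge> x" for y
      using fneg[OF that] q[of y] x that m by (simp add: mult_nonneg_nonpos mult_nonpos_nonneg)
    have "q x + ?c * (x + 1 - x) \<le> q (x + 1)"
    proof (rule deriv_lower_bound[OF _ sub[OF x]])
      fix z assume "z \<in> {x..x + 1}"
      then have z: "z \<ge> x" "z \<le> x + 1" by auto
      show "(q has_real_derivative (2 * m + 1) * (u z)\<^sup>2 - (m + 2) * f z * q z) (at z within {0..})"
        using z x s by (intro dq) auto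
      have "\<bar>u (x + 1)\<bar> \<le> \<bar>u z\<bar>" using umono[of z "x + 1"] u[of "x + 1"] u[of z] x z by simp
      then have "?c \<le> (2 * m + 1) * (u z)\<^sup>2" using m by (intro mult_left_mono) (auto simp: abs_le_square_iff)
      then show "?c \<le> (2 * m + 1) * (u z)\<^sup>2 - (m + 2) * f z * q z" using fq[OF z(1)] by linarith
    qed simp
    then have c1: "?c \<le> q (x + 1)" using q[OF x] by simp
    have "?c \<le> q y" if y: "y \<ge> x + 1" for y
    proof -
      have "q (x + 1) + 0 * (y - (x + 1)) \<le> q y"
      proof (rule deriv_lower_bound[OF y sub])
        fix z assume "z \<in> {x + 1..y}"
        then have z: "z \<ge> x" "z \<ge> 0" using x s by auto
        show "(q has_real_derivative (2 * m + 1) * (u z)\<^sup>2 - (m + 2) * f z * q z) (at z within {0..})" by (rule dq[OF z(2)])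
        have "0 \<le> (2 * m + 1) * (u z)\<^sup>2" using m by simp
        then show "0 \<le> (2 * m + 1) * (u z)\<^sup>2 - (m + 2) * f z * q z" using fq[OF z(1)] by linarith
      qed (use x in simp)
      then show ?thesis using c1 by simp
    qed
    then show False using no_growth[of "x + 1" ?c] c x by simp
  qed
  \<comment> \<open>The expression has derivative \<open>3 * (m + 1) * u^2\<close>. As
    \<open>f * u < 0\<close>, a positive value would be a permanent lower bound for
    \<open>q\<close>. Divided by \<open>- u\<close>, the claim becomes
    \<open>r \<le> (m + 2) * f\<close>.\<close>
  have w: "q x + (m + 2) * f x * u x \<le> 0" if x: "x \<ge> s" for x
  proof (rule ccontr)
    assume c: "\<not> ?thesis"
    have ge: "q x + (m + 2) * f x * u x \<le> q y" if y: "y \<ge> x" for y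
    proof -
      have "q x + (m + 2) * f x * u x + 0 * (y - x) \<le> q y + (m + 2) * f y * u y"
      proof (rule deriv_lower_bound[OF y sub[OF x]])
        fix z assume "z \<in> {x..y}"
        then have z: "z \<ge> 0" using x s by auto
        show "((\<lambda>z. q z + (m + 2) * f z * u z) has_real_derivative 3 * (m + 1) * (u z)\<^sup>2) (at z within {0..})"
          by (rule derivative_eq_intros df[OF z] du[OF z] dq[OF z] refl)+ (simp add: algebra_simps power2_eq_square)
        show "0 \<le> 3 * (m + 1) * (u z)\<^sup>2" using m by simp
      qed
      moreover have "(m + 2) * f y * u y \<le> 0" using m f[of y] u[of y] x y by (simp add: mult_nonneg_nonpos)
      ultimately show ?thesis by linarith
    qed
    show False by (rule no_growth[OF x _ ge]) (use c in auto)
  qed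
  show False
  proof (rule no_convex_tail[OF m, where s=s and f=f and p="\<lambda>t. - u t" and r="\<lambda>t. - q t / u t"])
    fix x assume x: "x \<ge> s"
    then have x0: "x \<ge> 0" and s0: "{s..} \<subseteq> {0..}" using s by auto
    note d = df[OF x0, THEN DERIV_subset, OF s0] du[OF x0, THEN DERIV_subset, OF s0] dq[OF x0, THEN DERIV_subset, OF s0]
    have ux: "u x < 0" using u[OF x] .
    show "(f has_real_derivative - (- u x)) (at x within {s..})" using d(1) by simp
    show "((\<lambda>t. - u t) has_real_derivative - (- q x / u x) * - u x) (at x within {s..})"
      using DERIV_minus[OF d(2)] ux by simp
    have "((\<lambda>t. - q t / u t) has_real_derivative (- ((2 * m + 1) * (u x)\<^sup>2 - (m + 2) * f x * q x) * u x - (- q x) * q x) / (u x * u x)) (at x within {s..})"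
      by (intro DERIV_divide DERIV_minus d) (use ux in simp)
    moreover have "(- ((2 * m + 1) * (u x)\<^sup>2 - (m + 2) * f x * q x) * u x - (- q x) * q x) / (u x * u x) =
        (- q x / u x)\<^sup>2 - (m + 2) * f x * (- q x / u x) + (2 * m + 1) * - u x"
      using ux by (simp add: field_simps power2_eq_square)
    ultimately show "((\<lambda>t. - q t / u t) has_real_derivative (- q x / u x)\<^sup>2 - (m + 2) * f x * (- q x / u x) + (2 * m + 1) * - u x) (at x within {s..})"
      by simp
    show "0 < f x" "0 < - u x" "0 \<le> - q x / u x" using f[OF x] ux q[OF x] by (auto simp: divide_nonneg_neg)
    show "- q x / u x \<le> (m + 2) * f x" using w[OF x] ux by (simp add: field_simps)
  qed (use s tendsto_minus[OF u_lim] in auto)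
qed

lemma u_antimono:
  assumes "0 \<le> s" "s \<le> t"
  shows "u t \<le> u s"
proof -
  have "- u s + 0 * (t - s) \<le> - u t"
  proof (rule deriv_lower_bound[OF assms(2), where S="{0..}" and y="\<lambda>x. - u x"])
    fix x assume "x \<in> {s..t}"
    then have x: "x \<ge> 0" using assms by simp
    show "((\<lambda>z. - u z) has_real_derivative - q x) (at x within {0..})" by (intro DERIV_minus du x)
    show "0 \<le> - q x" using q_neg[OF x] by simp
  qed (use assms in auto)
  then show ?thesis by simp
qed

lemma u_nonneg:
  assumes t: "t \<ge> 0"
  shows "0 \<le> u t"
  using t by (intro tendsto_upperbound[OF u_lim]) (auto simp: eventually_at_top_linorder intro!: exI[of _ t] u_antimono)

text \<open>Since the slope is nonincreasing, the chord to the left of \<open>z\<close> has slope at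
  least \<open>u z\<close> and the chord to the right at most \<open>u z\<close>; eliminating
  \<open>u z\<close> yields the inequality.\<close>

lemma concave: "concave_on {0..} f"
proof -
  have seg: "(1 - t) * f x + t * f y \<le> f ((1 - t) * x + t * y)"
    if xy: "0 \<le> x" "x < y" and t: "0 < t" "t < 1" for x y t
  proof -
    define z where "z = (1 - t) * x + t * y"
    have z: "z - x = t * (y - x)" "y - z = (1 - t) * (y - x)" by (simp_all add: z_def algebra_simps)
    have "0 < t * (y - x)" "0 < (1 - t) * (y - x)" using xy t by simp_all
    then have z': "x < z" "z < y" by (simp_all flip: z)
    have z0: "0 \<le> z" using z' xy by linarith
    have "f x + u z * (z - x) \<le> f z"
      using z' xy by (intro deriv_lower_bound[where S="{0..}" and y'=u] df u_antimono) auto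
    then have "f x + u z * (t * (y - x)) \<le> f z" by (simp only: z)
    then have "(1 - t) * (u z * (t * (y - x))) \<le> (1 - t) * (f z - f x)"
      using t by (intro mult_left_mono) linarith+
    moreover have "- f z + (- u z) * (y - z) \<le> - f y"
      using z' z0 by (intro deriv_lower_bound[where S="{0..}" and y'="\<lambda>x. - u x"] DERIV_minus df le_imp_neg_le u_antimono) auto
    then have "- f z + (- u z) * ((1 - t) * (y - x)) \<le> - f y" by (simp only: z)
    then have "t * (f y - f z) \<le> t * (u z * ((1 - t) * (y - x)))"
      using t by (intro mult_left_mono) linarith+
    ultimately show ?thesis unfolding z_def[symmetric] by (simp add: algebra_simps)
  qed
  show ?thesis
    unfolding concave_on_iff
  proof (intro conjI ballI allI impI)
    show "convex {0::real..}" by simp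
    fix x y a b :: real
    assume "x \<in> {0..}" "y \<in> {0..}" "0 \<le> a" "0 \<le> b" "a + b = 1"
    then have xy: "0 \<le> x" "0 \<le> y" and ab: "0 \<le> a" "0 \<le> b" "1 - b = a" "1 - a = b" by auto
    consider "x = y" | "a = 0" | "b = 0" | "x < y" "0 < b" "b < 1" | "y < x" "0 < a" "a < 1"
      using ab by linarith
    then show "a * f x + b * f y \<le> f (a *\<^sub>R x + b *\<^sub>R y)"
    proof cases
      case 1
      then show ?thesis using \<open>a + b = 1\<close> by (simp flip: distrib_right)
    next
      case 4
      then show ?thesis using seg[of x y b] xy ab by simp
    next
      case 5
      then show ?thesis using seg[of y x a] xy ab by (simp add: add.commute)
    qed (use ab in auto)
  qed
qed

end

text \<open>The difference of two concave solutions satisfies a linear system whose off-diagonal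
  coefficients are nonnegative. So an initial gap between the slopes never shrinks, contradicting
  that both slopes tend to 0.\<close>

lemma similarity_flow_unique:
  assumes F: "similarity_flow m f u q" and G: "similarity_flow m g v w"
    and init: "f 0 = g 0" "q 0 = w 0" and le: "u 0 \<le> v 0" and t: "t \<ge> 0"
  shows "g t = f t"
proof -
  interpret F: similarity_flow m f u q by fact
  interpret G: similarity_flow m g v w by fact
  \<comment> \<open>The products are split so that \<open>g\<close>, whose sign is unknown,
    multiplies only the diagonal term \<open>w - q\<close>. The other two coefficients,
    \<open>- (m + 2) * q\<close> and \<open>(2 * m + 1) * (u + v)\<close>, are nonnegative by the
    signs already proved.\<close>
  let ?q' = "\<lambda>x. - (m + 2) * g x * (w x - q x) - (m + 2) * q x * (g x - f x) + (2 * m + 1) * (u x + v x) * (v x - u x)"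
  have dh: "((\<lambda>x. g x - f x) has_real_derivative v x - u x) (at x within {0..})"
     "((\<lambda>x. v x - u x) has_real_derivative w x - q x) (at x within {0..})"
     "((\<lambda>x. w x - q x) has_real_derivative ?q' x) (at x within {0..})" if x: "x \<ge> 0" for x
  proof -
    have "((\<lambda>x. w x - q x) has_real_derivative ((2 * m + 1) * (v x)\<^sup>2 - (m + 2) * g x * w x)
       - ((2 * m + 1) * (u x)\<^sup>2 - (m + 2) * f x * q x)) (at x within {0..})"
      by (intro DERIV_diff F.dq G.dq x)
    then show "((\<lambda>x. w x - q x) has_real_derivative ?q' x) (at x within {0..})"
      by (simp add: algebra_simps power2_eq_square)
  qed (intro DERIV_diff F.df G.df F.du G.du x)+
  have sub: "{0..T} \<subseteq> {0..}" for T :: real by auto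
  have cont: "continuous_on {0..T} f" "continuous_on {0..T} u" "continuous_on {0..T} q"
     "continuous_on {0..T} g" "continuous_on {0..T} v" "continuous_on {0..T} w" for T
    by (rule continuous_on_subset[OF _ sub], rule F.continuous G.continuous)+
  have "u 0 = v 0"
  proof (rule ccontr)
    assume "u 0 \<noteq> v 0"
    then have d: "0 < v 0 - u 0" using le by simp
    \<comment> \<open>Half the gap leaves room for a first-time argument: up to the time
      \<open>T\<close> when the gap would shrink to one half, all three differences are nonnegative,
      so the gap at \<open>T\<close> is still at least the initial one.\<close>
    have big: "(v 0 - u 0) / 2 < v x - u x" if x: "x \<ge> 0" for x
    proof (rule ccontr)
      assume "\<not> ?thesis"
      then have y: "0 < v 0 - u 0 - (v 0 - u 0) / 2" "v x - u x - (v 0 - u 0) / 2 \<le> 0" using d by simp_all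
      have "continuous_on {0..x} (\<lambda>x. v x - u x - (v 0 - u 0) / 2)" by (intro continuous_intros cont)
      from first_zero[OF this x y] obtain T where T: "0 < T" "v T - u T - (v 0 - u 0) / 2 = 0" "\<And>x. 0 \<le> x \<Longrightarrow> x < T \<Longrightarrow> 0 < v x - u x - (v 0 - u 0) / 2"
        by blast
      have hu: "0 \<le> v x - u x" if "x \<in> {0..T}" for x using T(2) T(3)[of x] that d by (cases "x = T") auto
      have h: "0 \<le> g x - f x" if "x \<in> {0..T}" for x
        using deriv_lower_bound[where y="\<lambda>x. g x - f x" and y'="\<lambda>x. v x - u x" and S="{0..}" and s=0 and t=x and c=0] dh(1) hu init that by auto
      have hq: "0 \<le> w x - q x" if x: "x \<in> {0..T}" for x
      proof (rule linear_diff_ineq(1)[where y="\<lambda>x. w x - q x" and S="{0..}" and s=0 and t=x and k="\<lambda>x. - (m + 2) * g x"])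
        fix z assume z: "z \<in> {0..x}"
        show "((\<lambda>x. w x - q x) has_real_derivative ?q' z) (at z within {0..})" using dh(3) z by simp
        have "0 \<le> (m + 2) * (- q z) * (g z - f z)" "0 \<le> (2 * m + 1) * (u z + v z) * (v z - u z)"
          by (intro mult_nonneg_nonneg; use F.m F.q_neg[of z] F.u_nonneg[of z] G.u_nonneg[of z] h[of z] hu[of z] z x in simp)+
        then show "- (m + 2) * g z * (w z - q z) \<le> ?q' z" by simp
      qed (use x init in \<open>auto intro!: continuous_intros cont\<close>)
      have "v 0 - u 0 + 0 * (T - 0) \<le> v T - u T"
        using T(1) dh(2) hq by (intro deriv_lower_bound[where S="{0..}" and y'="\<lambda>x. w x - q x"]) auto
      then show False using T(2) d by simp
    qed
    have "((\<lambda>x. v x - u x) \<longlongrightarrow> 0 - 0) at_top" by (intro tendsto_diff F.u_lim G.u_lim)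
    moreover have "\<forall>\<^sub>F x in at_top. (v 0 - u 0) / 2 \<le> v x - u x"
      using eventually_ge_at_top[of 0] by eventually_elim (rule less_imp_le[OF big])
    ultimately have "(v 0 - u 0) / 2 \<le> 0 - 0"
      by (rule tendsto_lowerbound) simp
    then show False using d by simp
  qed
  \<comment> \<open>Now all initial data agree, and \<open>N' \<le> k * N\<close> forces
    \<open>N\<close> to vanish. The inequality is used for \<open>- N\<close> because
    \<open>linear_diff_ineq\<close> propagates nonnegativity.\<close>
  define N where "N = (\<lambda>x. (g x - f x)\<^sup>2 + (v x - u x)\<^sup>2 + (w x - q x)\<^sup>2)"
  define k where "k = (\<lambda>x. 2 + 2 * (m + 2) * \<bar>g x\<bar> + (m + 2) * \<bar>q x\<bar> + (2 * m + 1) * \<bar>u x + v x\<bar>)"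
  have "0 \<le> - N t"
  proof (rule linear_diff_ineq(1)[where y="\<lambda>x. - N x" and S="{0..}" and s=0 and t=t and k=k])
    fix z assume "z \<in> {0..t}"
    then have z: "z \<ge> 0" by simp
    let ?N' = "2 * (g z - f z) * (v z - u z) + 2 * (v z - u z) * (w z - q z) + 2 * (w z - q z) * ?q' z"
    have sq: "((\<lambda>x. (y x)\<^sup>2) has_real_derivative 2 * y z * y') (at z within {0..})"
      if "(y has_real_derivative y') (at z within {0..})" for y y'
      by (rule derivative_eq_intros that refl)+ simp
    show "((\<lambda>x. - N x) has_real_derivative - ?N') (at z within {0..})"
      unfolding N_def by (intro DERIV_minus DERIV_add sq dh z)
    define H P Q where HPQ: "H = g z - f z" "P = v z - u z" "Q = w z - q z"
    have i1: "2 * H * P \<le> H\<^sup>2 + P\<^sup>2" "2 * P * Q \<le> P\<^sup>2 + Q\<^sup>2"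
      by (simp_all add: sum_squares_bound)
    have i2: "- g z * Q\<^sup>2 \<le> \<bar>g z\<bar> * Q\<^sup>2" by (intro mult_right_mono) auto
    have am: "x * (2 * Q * y) \<le> \<bar>x\<bar> * (Q\<^sup>2 + y\<^sup>2)" for x y :: real
    proof -
      have "\<bar>2 * Q * y\<bar> \<le> Q\<^sup>2 + y\<^sup>2"
        using zero_le_power2[of "Q - y"] zero_le_power2[of "Q + y"] by (auto simp: abs_le_iff power2_eq_square algebra_simps)
      then have "\<bar>x\<bar> * \<bar>2 * Q * y\<bar> \<le> \<bar>x\<bar> * (Q\<^sup>2 + y\<^sup>2)" by (intro mult_left_mono) auto
      then show ?thesis using abs_ge_self[of "x * (2 * Q * y)"] by (simp add: abs_mult)
    qed
    have j: "(2 * (m + 2)) * (- g z * Q\<^sup>2) \<le> (2 * (m + 2)) * (\<bar>g z\<bar> * Q\<^sup>2)"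
       "(m + 2) * (- q z * (2 * Q * H)) \<le> (m + 2) * (\<bar>q z\<bar> * (Q\<^sup>2 + H\<^sup>2))"
       "(2 * m + 1) * ((u z + v z) * (2 * Q * P)) \<le> (2 * m + 1) * (\<bar>u z + v z\<bar> * (Q\<^sup>2 + P\<^sup>2))"
      using F.m i2 am[of "- q z" H] am[of "u z + v z" P] by (intro mult_left_mono; simp)+
    have nn: "0 \<le> (2 * (m + 2)) * (\<bar>g z\<bar> * (H\<^sup>2 + P\<^sup>2))" "0 \<le> (m + 2) * (\<bar>q z\<bar> * P\<^sup>2)" "0 \<le> (2 * m + 1) * (\<bar>u z + v z\<bar> * H\<^sup>2)"
      using F.m by simp_all
    have "?N' = 2 * H * P + 2 * P * Q + (2 * (m + 2)) * (- g z * Q\<^sup>2) + (m + 2) * (- q z * (2 * Q * H)) + (2 * m + 1) * ((u z + v z) * (2 * Q * P))"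
      unfolding HPQ[symmetric] by (simp add: algebra_simps power2_eq_square)
    also have "\<dots> \<le> (H\<^sup>2 + P\<^sup>2) + (P\<^sup>2 + Q\<^sup>2) + (2 * (m + 2)) * (\<bar>g z\<bar> * Q\<^sup>2) + (m + 2) * (\<bar>q z\<bar> * (Q\<^sup>2 + H\<^sup>2)) + (2 * m + 1) * (\<bar>u z + v z\<bar> * (Q\<^sup>2 + P\<^sup>2))
        + (2 * (m + 2)) * (\<bar>g z\<bar> * (H\<^sup>2 + P\<^sup>2)) + (m + 2) * (\<bar>q z\<bar> * P\<^sup>2) + (2 * m + 1) * (\<bar>u z + v z\<bar> * H\<^sup>2) + H\<^sup>2 + Q\<^sup>2"
      using i1 j nn zero_le_power2[of H] zero_le_power2[of Q] by linarith
    also have "\<dots> = k z * N z" unfolding k_def N_def HPQ[symmetric] by (simp add: algebra_simps)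
    finally show "k z * - N z \<le> - ?N'" by simp
  next
    show "continuous_on {0..t} k" unfolding k_def by (intro continuous_intros cont)
    show "0 \<le> - N 0" using init \<open>u 0 = v 0\<close> by (simp add: N_def)
  qed (use t in auto)
  moreover have "(g t - f t)\<^sup>2 \<le> N t" by (simp add: N_def)
  ultimately have "(g t - f t)\<^sup>2 \<le> 0" by linarith
  then show ?thesis by simp
qed

section \<open>Global solutions of the truncated equation\<close>

text \<open>The interval \<open>{0..t + 1}\<close> coincides with the half-line near
  \<open>t\<close>, so the derivative within one is the derivative within the other.\<close>

lemma integral_has_vector_derivative_half_line:
  fixes h :: "real \<Rightarrow> 'a::banach"
  assumes h: "continuous_on {0..} h" and t: "t \<ge> 0"
  shows "((\<lambda>t. integral {0..t} h) has_vector_derivative h t) (at t within {0..})"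
proof -
  have "((\<lambda>t. integral {0..t} h) has_vector_derivative h t) (at t within {0..t + 1})"
    using t by (intro integral_has_vector_derivative continuous_on_subset[OF h]) auto
  moreover have "at t within {0..t + 1} = at t within {0..}"
    by (rule at_within_nhd[where S="{..<t + 1}"]) (use t in auto)
  ultimately show ?thesis by simp
qed

text \<open>With respect to the norm \<open>sup |x t| * exp (- L t)\<close> the Picard operator contracts by the
  factor \<open>1/2\<close>, so one fixed point gives the solution on the whole half-line.\<close>

lemma global_flow:
  fixes F :: "real \<Rightarrow> 'a::banach \<Rightarrow> 'a" and K L :: "real \<Rightarrow> real"
  assumes cont: "continuous_on ({0..} \<times> UNIV) (\<lambda>(t, x). F t x)"
    and lip: "\<And>t x y. t \<ge> 0 \<Longrightarrow> norm (F t x - F t y) \<le> K t * norm (x - y)"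
    and zero: "\<And>t. t \<ge> 0 \<Longrightarrow> F t 0 = 0"
    and dL: "\<And>t. t \<ge> 0 \<Longrightarrow> (L has_real_derivative 2 * K t) (at t within {0..})"
    and K: "\<And>t. t \<ge> 0 \<Longrightarrow> 0 \<le> K t" and L0: "0 \<le> L 0"
  shows "\<exists>X. \<forall>x0. X x0 0 = x0 \<and>
    (\<forall>t\<ge>0. (X x0 has_vector_derivative F t (X x0 t)) (at t within {0..})) \<and>
    (\<forall>y0. \<forall>t\<ge>0. norm (X x0 t - X y0 t) \<le> 2 * exp (L t) * norm (x0 - y0))"
proof -
  \<comment> \<open>The unknown is the weighted function \<open>exp (- L) * x\<close>, which turns
    the weighted norm into the norm of \<open>bcontfun\<close>. Its members live on the whole line,
    so \<open>max 0 t\<close> extends the operator constantly to negative times.\<close>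
  define I where "I = (\<lambda>u s. F s (exp (L s) *\<^sub>R apply_bcontfun u s))"
  define P where "P = (\<lambda>x0 u t. exp (- L (max 0 t)) *\<^sub>R (x0 + integral {0..max 0 t} (I u)))"
  have Lcont: "continuous_on {0..} L"
    by (rule DERIV_continuous_on, erule dL[OF atLeast_iff[THEN iffD1]])
  have Lnonneg: "0 \<le> L t" if t: "t \<ge> 0" for t
    using deriv_lower_bound[OF t, of "{0..}" L "\<lambda>t. 2 * K t" 0] dL K L0 by auto
  have Icont: "continuous_on {0..} (I u)" for u
  proof -
    have "continuous_on {0..} (\<lambda>s. (\<lambda>(t, x). F t x) (s, exp (L s) *\<^sub>R apply_bcontfun u s))"
      by (rule continuous_on_compose2[OF cont]) (auto intro!: continuous_intros Lcont)
    then show ?thesis by (simp add: I_def)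
  qed
  have Iint: "I u integrable_on {0..t}" for u t
    by (rule integrable_continuous_real[OF continuous_on_subset[OF Icont]]) auto
  \<comment> \<open>\<open>L' = 2 * K\<close> makes \<open>exp L / 2\<close> an antiderivative of
    \<open>K * exp L\<close>; this is the origin of the factor 1/2.\<close>
  have est: "norm (integral {0..t} (I u) - integral {0..t} (I v)) \<le> exp (L t) / 2 * dist u v"
    if t: "t \<ge> 0" for u v t
  proof -
    have hi: "((\<lambda>s. K s * exp (L s) * dist u v) has_integral exp (L t) / 2 * dist u v - exp (L 0) / 2 * dist u v) {0..t}"
    proof (rule fundamental_theorem_of_calculus[OF t])
      fix x assume x: "x \<in> {0..t}"
      have "(L has_real_derivative 2 * K x) (at x within {0..t})"
        using x by (intro DERIV_subset[OF dL]) auto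
      then have "((\<lambda>s. exp (L s) / 2 * dist u v) has_real_derivative K x * exp (L x) * dist u v) (at x within {0..t})"
        by (auto intro!: derivative_eq_intros)
      then show "((\<lambda>s. exp (L s) / 2 * dist u v) has_vector_derivative K x * exp (L x) * dist u v) (at x within {0..t})"
        by (simp add: has_real_derivative_iff_has_vector_derivative)
    qed
    have "norm (integral {0..t} (\<lambda>s. I u s - I v s)) \<le> integral {0..t} (\<lambda>s. K s * exp (L s) * dist u v)"
    proof (rule integral_norm_bound_integral)
      show "(\<lambda>s. I u s - I v s) integrable_on {0..t}" by (intro integrable_diff Iint)
      show "(\<lambda>s. K s * exp (L s) * dist u v) integrable_on {0..t}" using hi by blast
      fix s assume "s \<in> {0..t}"
      then have s: "s \<ge> 0" by simp
      have "norm (I u s - I v s) \<le> K s * norm (exp (L s) *\<^sub>R (apply_bcontfun u s - apply_bcontfun v s))"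
        unfolding I_def using lip[OF s] by (simp add: scaleR_diff_right)
      also have "\<dots> = K s * exp (L s) * dist (apply_bcontfun u s) (apply_bcontfun v s)" by (simp add: dist_norm)
      also have "\<dots> \<le> K s * exp (L s) * dist u v"
        using K[OF s] by (intro mult_left_mono dist_bounded) auto
      finally show "norm (I u s - I v s) \<le> K s * exp (L s) * dist u v" .
    qed
    also have "\<dots> = exp (L t) / 2 * dist u v - exp (L 0) / 2 * dist u v" using hi by (rule integral_unique)
    also have "\<dots> \<le> exp (L t) / 2 * dist u v" by simp
    finally show ?thesis using Iint by (simp add: integral_diff)
  qed
  have Pdist: "dist (P x0 u t) (P y0 v t) \<le> norm (x0 - y0) + dist u v / 2" for x0 y0 u v t
  proof -
    let ?s = "max 0 t"
    have "dist (P x0 u t) (P y0 v t) = exp (- L ?s) * norm ((x0 - y0) + (integral {0..?s} (I u) - integral {0..?s} (I v)))"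
      unfolding P_def dist_norm by (simp flip: scaleR_diff_right) (simp add: algebra_simps)
    also have "\<dots> \<le> exp (- L ?s) * (norm (x0 - y0) + exp (L ?s) / 2 * dist u v)"
      by (intro mult_left_mono order_trans[OF norm_triangle_ineq] add_left_mono est) auto
    also have "\<dots> = exp (- L ?s) * norm (x0 - y0) + dist u v / 2"
      by (simp add: distrib_left exp_minus field_simps)
    also have "\<dots> \<le> 1 * norm (x0 - y0) + dist u v / 2"
      using Lnonneg[of ?s] by (intro add_right_mono mult_right_mono) auto
    finally show ?thesis by simp
  qed
  have intcont: "continuous_on UNIV (\<lambda>t. integral {0..max 0 t} (I u))" for u
  proof (rule continuous_on_compose2[of "{0..}" "\<lambda>t. integral {0..t} (I u)"])
    show "continuous_on {0..} (\<lambda>t. integral {0..t} (I u))"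
      using integral_has_vector_derivative_half_line[OF Icont]
      by (intro continuous_on_vector_derivative) auto
  qed (auto intro!: continuous_intros)
  have Lcont': "continuous_on UNIV (\<lambda>t. L (max 0 t))"
    by (rule continuous_on_compose2[OF Lcont]) (auto intro!: continuous_intros)
  \<comment> \<open>Comparison with this trivial orbit is what bounds \<open>P x0 u\<close> and
    places it in \<open>bcontfun\<close>.\<close>
  have P0: "P 0 0 t = 0" for t
  proof -
    have "integral {0..max 0 t} (I 0) = 0"
      by (rule integral_unique, rule has_integral_is_0) (auto simp: I_def zero)
    then show ?thesis by (simp add: P_def)
  qed
  have "P x0 u \<in> bcontfun" for x0 u
  proof (rule bcontfun_normI)
    show "continuous_on UNIV (P x0 u)"
      unfolding P_def by (intro continuous_intros intcont Lcont')
    show "norm (P x0 u t) \<le> norm x0 + norm u / 2" for t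
      using Pdist[of x0 u t 0 0] by (simp add: P0)
  qed
  then have app: "apply_bcontfun (Bcontfun (P x0 u)) = P x0 u" for x0 u
    by (rule Bcontfun_inverse)
  have "\<exists>u. Bcontfun (P x0 u) = u" for x0
  proof -
    have "\<exists>!u. Bcontfun (P x0 u) = u"
    proof (rule banach_fix_type[of "1/2"])
      show "\<forall>u v. dist (Bcontfun (P x0 u)) (Bcontfun (P x0 v)) \<le> 1/2 * dist u v"
        using Pdist[of x0 _ _ x0] by (intro allI, intro dist_bound) (simp add: app)
    qed auto
    then show ?thesis by blast
  qed
  then obtain U where U: "\<And>x0. Bcontfun (P x0 (U x0)) = U x0" by metis
  have U': "apply_bcontfun (U x0) t = P x0 (U x0) t" for x0 t using U app by metis
  have Udist: "dist (U x0) (U y0) \<le> 2 * norm (x0 - y0)" for x0 y0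
  proof -
    have "dist (U x0) (U y0) \<le> norm (x0 - y0) + dist (U x0) (U y0) / 2"
      by (rule dist_bound) (subst (1 2) U', rule Pdist)
    then show ?thesis by simp
  qed
  define X where "X = (\<lambda>x0 t. exp (L t) *\<^sub>R apply_bcontfun (U x0) t)"
  have X: "X x0 t = x0 + integral {0..t} (I (U x0))" if "t \<ge> 0" for x0 t
    using that unfolding X_def U' P_def by (simp add: max_def flip: exp_add)
  have "X x0 0 = x0" for x0 using X[of 0 x0] by simp
  moreover have "(X x0 has_vector_derivative F t (X x0 t)) (at t within {0..})" if t: "t \<ge> 0" for x0 t
  proof (rule has_vector_derivative_transform[of t "{0..}" "X x0"])
    show "((\<lambda>t. x0 + integral {0..t} (I (U x0))) has_vector_derivative F t (X x0 t)) (at t within {0..})"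
      using has_vector_derivative_add[OF has_vector_derivative_const[of x0] integral_has_vector_derivative_half_line[OF Icont t, of "U x0"]]
      by (simp add: X_def I_def)
  qed (use t X in auto)
  moreover have "norm (X x0 t - X y0 t) \<le> 2 * exp (L t) * norm (x0 - y0)" for x0 y0 t
  proof -
    have "norm (X x0 t - X y0 t) = exp (L t) * dist (apply_bcontfun (U x0) t) (apply_bcontfun (U y0) t)"
      unfolding X_def dist_norm by (simp flip: scaleR_diff_right)
    also have "\<dots> \<le> exp (L t) * (2 * norm (x0 - y0))"
      by (intro mult_left_mono order_trans[OF dist_bounded Udist]) auto
    finally show ?thesis by simp
  qed
  ultimately show ?thesis by (intro exI[of _ X]) auto
qed

section \<open>Clipping the quadratic terms\<close>

definition cut :: "real \<Rightarrow> real \<Rightarrow> real" where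
  "cut b x = max (- b) (min b x)"

lemma cut_eq: "\<bar>x\<bar> \<le> b \<Longrightarrow> cut b x = x"
  by (auto simp: cut_def)

lemma abs_cut_le: "0 \<le> b \<Longrightarrow> \<bar>cut b x\<bar> \<le> b"
  by (auto simp: cut_def)

lemma abs_cut_diff_le: "\<bar>cut b x - cut b y\<bar> \<le> \<bar>x - y\<bar>"
  by (auto simp: cut_def max_def min_def)

text \<open>Multiplication is not globally Lipschitz, but clipped factors are bounded by
  \<open>b\<close> and 1-Lipschitz, so telescoping gives the constant \<open>2 * b\<close>.\<close>

lemma abs_cut_prod_diff_le:
  assumes "0 \<le> b" "\<bar>x - y\<bar> \<le> d" "\<bar>z - w\<bar> \<le> d"
  shows "\<bar>cut b x * cut b z - cut b y * cut b w\<bar> \<le> 2 * b * d"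
proof -
  have "cut b x * cut b z - cut b y * cut b w = cut b x * (cut b z - cut b w) + (cut b x - cut b y) * cut b w"
    by (simp add: algebra_simps)
  also have "\<bar>\<dots>\<bar> \<le> \<bar>cut b x\<bar> * \<bar>cut b z - cut b w\<bar> + \<bar>cut b x - cut b y\<bar> * \<bar>cut b w\<bar>"
    using abs_triangle_ineq by (simp add: abs_mult[symmetric])
  also have "\<dots> \<le> b * d + d * b"
    using assms abs_cut_le[of b] abs_cut_diff_le[of b x y] abs_cut_diff_le[of b z w]
    by (intro add_mono mult_mono) auto
  finally show ?thesis by simp
qed

lemma abs_components_le_norm:
  fixes Z :: "real \<times> real \<times> real"
  shows "\<bar>fst Z\<bar> \<le> norm Z" "\<bar>fst (snd Z)\<bar> \<le> norm Z" "\<bar>snd (snd Z)\<bar> \<le> norm Z"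
proof -
  obtain a b c where Z: "Z = (a, b, c)" by (cases Z)
  have "\<bar>a\<bar> \<le> norm Z" "norm (b, c) \<le> norm Z" "\<bar>b\<bar> \<le> norm (b, c)" "\<bar>c\<bar> \<le> norm (b, c)"
    unfolding Z real_norm_def[symmetric] by (rule norm_fst_le norm_snd_le)+
  then show "\<bar>fst Z\<bar> \<le> norm Z" "\<bar>fst (snd Z)\<bar> \<le> norm Z" "\<bar>snd (snd Z)\<bar> \<le> norm Z"
    by (simp_all add: Z)
qed

text \<open>The cut-off at level \<open>B t\<close> makes the vector field globally Lipschitz; along concave
  solutions with bounded initial slope it is inactive.\<close>

lemma truncated_flow:
  fixes m \<gamma> \<kappa> :: real
  assumes m: "- 1/2 < m" "m \<le> 1" and \<kappa>: "1 \<le> \<kappa>"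
  defines "B \<equiv> \<lambda>t. \<kappa> * exp (\<kappa> * t)"
  shows "\<exists>x p q :: real \<Rightarrow> real \<Rightarrow> real. \<forall>\<alpha>. x \<alpha> 0 = - \<gamma> \<and> p \<alpha> 0 = \<alpha> \<and> q \<alpha> 0 = - 1 \<and>
    (\<forall>t\<ge>0. (x \<alpha> has_real_derivative p \<alpha> t) (at t within {0..}) \<and>
      (p \<alpha> has_real_derivative q \<alpha> t) (at t within {0..}) \<and>
      (q \<alpha> has_real_derivative (2 * m + 1) * (cut (B t) (p \<alpha> t))\<^sup>2 - (m + 2) * cut (B t) (x \<alpha> t) * cut (B t) (q \<alpha> t)) (at t within {0..}) \<and>
      (\<forall>\<beta>. \<bar>p \<alpha> t - p \<beta> t\<bar> \<le> 2 * exp (28 * exp (\<kappa> * t)) * \<bar>\<alpha> - \<beta>\<bar> \<and>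
           \<bar>q \<alpha> t - q \<beta> t\<bar> \<le> 2 * exp (28 * exp (\<kappa> * t)) * \<bar>\<alpha> - \<beta>\<bar>))"
proof -
  define F :: "real \<Rightarrow> real \<times> real \<times> real \<Rightarrow> real \<times> real \<times> real" where
    "F = (\<lambda>t X. (fst (snd X), snd (snd X),
      (2 * m + 1) * (cut (B t) (fst (snd X)) * cut (B t) (fst (snd X))) - (m + 2) * (cut (B t) (fst X) * cut (B t) (snd (snd X)))))"
  have B: "1 \<le> B t" if "t \<ge> 0" for t
  proof -
    have "1 * 1 \<le> \<kappa> * exp (\<kappa> * t)" using \<kappa> that by (intro mult_mono) auto
    then show ?thesis by (simp add: B_def)
  qed
  have "\<exists>X. \<forall>x0. X x0 0 = x0 \<and>
    (\<forall>t\<ge>0. (X x0 has_vector_derivative F t (X x0 t)) (at t within {0..})) \<and>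
    (\<forall>y0. \<forall>t\<ge>0. norm (X x0 t - X y0 t) \<le> 2 * exp (28 * exp (\<kappa> * t)) * norm (x0 - y0))"
  \<comment> \<open>Both coefficients lie between 0 and 3 and each clipped product contributes
    \<open>2 * B\<close>, so the Lipschitz constant is at most
    \<open>2 + 12 * B \<le> 14 * B\<close>, using \<open>B \<ge> 1\<close>. The weight
    \<open>28 * exp (\<kappa> * t)\<close> has derivative \<open>28 * B\<close>.\<close>
  proof (rule global_flow[where K="\<lambda>t. 14 * B t"])
    show "continuous_on ({0..} \<times> UNIV) (\<lambda>(t, X). F t X)"
      unfolding F_def B_def cut_def case_prod_beta
      by (intro continuous_intros)
    show "F t 0 = 0" if "t \<ge> 0" for t
      using B[OF that] by (simp add: F_def cut_eq zero_prod_def)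
    show "((\<lambda>t. 28 * exp (\<kappa> * t)) has_real_derivative 2 * (14 * B t)) (at t within {0..})" for t
      unfolding B_def by (auto intro!: derivative_eq_intros)
    show "0 \<le> 14 * B t" if "t \<ge> 0" for t using B[OF that] by simp
    fix t :: real and X Y :: "real \<times> real \<times> real" assume t: "0 \<le> t"
    define d where "d = norm (X - Y)"
    have d: "\<bar>fst X - fst Y\<bar> \<le> d" "\<bar>fst (snd X) - fst (snd Y)\<bar> \<le> d" "\<bar>snd (snd X) - snd (snd Y)\<bar> \<le> d"
      using abs_components_le_norm[of "X - Y"] by (simp_all add: d_def)
    define c1 where "c1 = cut (B t) (fst (snd X)) * cut (B t) (fst (snd X)) - cut (B t) (fst (snd Y)) * cut (B t) (fst (snd Y))"
    define c2 where "c2 = cut (B t) (fst X) * cut (B t) (snd (snd X)) - cut (B t) (fst Y) * cut (B t) (snd (snd Y))"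
    have c: "\<bar>c1\<bar> \<le> 2 * B t * d" "\<bar>c2\<bar> \<le> 2 * B t * d"
      unfolding c1_def c2_def using B[OF t] d by (intro abs_cut_prod_diff_le; simp)+
    have d0: "0 \<le> d" by (simp add: d_def)
    have "F t X - F t Y = (fst (snd X) - fst (snd Y), snd (snd X) - snd (snd Y), (2 * m + 1) * c1 - (m + 2) * c2)"
      by (simp add: F_def c1_def c2_def algebra_simps)
    also have "norm \<dots> \<le> \<bar>fst (snd X) - fst (snd Y)\<bar> + (\<bar>snd (snd X) - snd (snd Y)\<bar> + \<bar>(2 * m + 1) * c1 - (m + 2) * c2\<bar>)"
      by (intro order_trans[OF norm_Pair_le] add_mono order_refl) (simp_all add: order_trans[OF norm_Pair_le])
    also have "\<dots> \<le> d + (d + (3 * (2 * B t * d) + 3 * (2 * B t * d)))"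
    proof -
      have "\<bar>(2 * m + 1) * c1\<bar> \<le> 3 * (2 * B t * d)" "\<bar>(m + 2) * c2\<bar> \<le> 3 * (2 * B t * d)"
        unfolding abs_mult using m c by (intro mult_mono; simp)+
      then show ?thesis using d by linarith
    qed
    also have "\<dots> \<le> 14 * B t * d"
      using mult_right_mono[OF B[OF t] d0] by (simp add: mult.commute)
    finally show "norm (F t X - F t Y) \<le> 14 * B t * norm (X - Y)" by (simp add: d_def)
  qed simp
  then obtain X where X: "\<And>x0. X x0 0 = x0"
    "\<And>x0 t. t \<ge> 0 \<Longrightarrow> (X x0 has_vector_derivative F t (X x0 t)) (at t within {0..})"
    "\<And>x0 y0 t. t \<ge> 0 \<Longrightarrow> norm (X x0 t - X y0 t) \<le> 2 * exp (28 * exp (\<kappa> * t)) * norm (x0 - y0)"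
    by blast
  define Z where "Z = (\<lambda>\<alpha>. X (- \<gamma>, \<alpha>, - 1))"
  have dZ: "((\<lambda>t. fst (Z \<alpha> t)) has_real_derivative fst (F t (Z \<alpha> t))) (at t within {0..})"
    "((\<lambda>t. fst (snd (Z \<alpha> t))) has_real_derivative fst (snd (F t (Z \<alpha> t)))) (at t within {0..})"
    "((\<lambda>t. snd (snd (Z \<alpha> t))) has_real_derivative snd (snd (F t (Z \<alpha> t)))) (at t within {0..})" if t: "t \<ge> 0" for \<alpha> t
    unfolding has_real_derivative_iff_has_vector_derivative Z_def
    by (intro bounded_linear.has_vector_derivative[OF bounded_linear_fst] bounded_linear.has_vector_derivative[OF bounded_linear_snd] X(2) t)+
  have "norm (Z \<alpha> t - Z \<beta> t) \<le> 2 * exp (28 * exp (\<kappa> * t)) * \<bar>\<alpha> - \<beta>\<bar>" if "t \<ge> 0" for \<alpha> \<beta> t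
    using X(3)[OF that, of "(- \<gamma>, \<alpha>, - 1)" "(- \<gamma>, \<beta>, - 1)"] by (simp add: Z_def norm_Pair)
  moreover have "\<bar>fst (snd (Z \<alpha> t)) - fst (snd (Z \<beta> t))\<bar> \<le> norm (Z \<alpha> t - Z \<beta> t)"
     "\<bar>snd (snd (Z \<alpha> t)) - snd (snd (Z \<beta> t))\<bar> \<le> norm (Z \<alpha> t - Z \<beta> t)" for \<alpha> \<beta> t
    using abs_components_le_norm[of "Z \<alpha> t - Z \<beta> t"] by simp_all
  ultimately have lipZ: "\<bar>fst (snd (Z \<alpha> t)) - fst (snd (Z \<beta> t))\<bar> \<le> 2 * exp (28 * exp (\<kappa> * t)) * \<bar>\<alpha> - \<beta>\<bar>"
     "\<bar>snd (snd (Z \<alpha> t)) - snd (snd (Z \<beta> t))\<bar> \<le> 2 * exp (28 * exp (\<kappa> * t)) * \<bar>\<alpha> - \<beta>\<bar>" if "t \<ge> 0" for \<alpha> \<beta> t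
    using that order_trans by blast+
  show ?thesis
    by (rule exI[of _ "\<lambda>\<alpha> t. fst (Z \<alpha> t)"], rule exI[of _ "\<lambda>\<alpha> t. fst (snd (Z \<alpha> t))"], rule exI[of _ "\<lambda>\<alpha> t. snd (snd (Z \<alpha> t))"])
      (use dZ lipZ in \<open>simp add: F_def Z_def X(1) power2_eq_square mult.assoc\<close>)
qed

text \<open>Only a compact time interval matters: \<open>z\<close> has a positive minimum there, and
  a change of \<open>\<alpha>\<close> by less than \<open>e / M t\<close> moves \<open>y\<close> at
  \<open>t\<close> and \<open>z\<close> on the whole interval by less than \<open>e\<close>.\<close>

lemma open_shooting_set:
  fixes y z :: "real \<Rightarrow> real \<Rightarrow> real" and M :: "real \<Rightarrow> real"
  assumes cont: "\<And>\<alpha>. continuous_on {0..} (z \<alpha>)"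
    and lip: "\<And>\<alpha> \<beta> t. t \<ge> 0 \<Longrightarrow> \<bar>y \<alpha> t - y \<beta> t\<bar> \<le> M t * \<bar>\<alpha> - \<beta>\<bar>"
      "\<And>\<alpha> \<beta> t. t \<ge> 0 \<Longrightarrow> \<bar>z \<alpha> t - z \<beta> t\<bar> \<le> M t * \<bar>\<alpha> - \<beta>\<bar>"
    and M: "\<And>s t. 0 \<le> s \<Longrightarrow> s \<le> t \<Longrightarrow> M s \<le> M t" "\<And>t. 0 < M t"
  shows "open {\<alpha>. \<exists>t\<ge>0. 0 < y \<alpha> t \<and> (\<forall>s\<in>{0..t}. 0 < z \<alpha> s)}"
  unfolding open_dist
proof (intro ballI, clarify)
  fix \<alpha> t assume t: "0 \<le> t" and y: "0 < y \<alpha> t" and z: "\<forall>s\<in>{0..t}. 0 < z \<alpha> s"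
  obtain s0 where s0: "s0 \<in> {0..t}" "\<And>s. s \<in> {0..t} \<Longrightarrow> z \<alpha> s0 \<le> z \<alpha> s"
    using continuous_attains_inf[of "{0..t}" "z \<alpha>"] t continuous_on_subset[OF cont[of \<alpha>], of "{0..t}"] by auto
  define e where "e = min (y \<alpha> t) (z \<alpha> s0)"
  have e: "0 < e" using y z s0(1) by (simp add: e_def)
  show "\<exists>d>0. \<forall>\<beta>. dist \<beta> \<alpha> < d \<longrightarrow> \<beta> \<in> {\<alpha>. \<exists>t\<ge>0. 0 < y \<alpha> t \<and> (\<forall>s\<in>{0..t}. 0 < z \<alpha> s)}"
  proof (intro exI[of _ "e / M t"] conjI allI impI)
    show "0 < e / M t" using e M(2) by simp
    fix \<beta> assume "dist \<beta> \<alpha> < e / M t"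
    then have b: "M t * \<bar>\<alpha> - \<beta>\<bar> < e"
      using M(2)[of t] by (simp add: dist_real_def field_simps abs_minus_commute)
    have "0 < y \<beta> t" using lip(1)[OF t, of \<alpha> \<beta>] b by (simp add: e_def abs_le_iff)
    moreover have "0 < z \<beta> s" if s: "s \<in> {0..t}" for s
    proof -
      have "M s * \<bar>\<alpha> - \<beta>\<bar> \<le> M t * \<bar>\<alpha> - \<beta>\<bar>" using M(1)[of s t] s by (intro mult_right_mono) auto
      then show ?thesis using lip(2)[of s \<alpha> \<beta>] s s0(2)[OF s] b by (simp add: e_def abs_le_iff)
    qed
    ultimately show "\<beta> \<in> {\<alpha>. \<exists>t\<ge>0. 0 < y \<alpha> t \<and> (\<forall>s\<in>{0..t}. 0 < z \<alpha> s)}" using t by blast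
  qed
qed

section \<open>Shooting\<close>

lemma persist_pos:
  fixes y :: "real \<Rightarrow> real"
  assumes "continuous_on {0..} y" "0 \<le> T" "0 < y T"
  obtains d where "0 < d" "\<And>t. T \<le> t \<Longrightarrow> t < T + d \<Longrightarrow> 0 < y t"
proof -
  obtain d where "0 < d" "\<And>t. t \<in> {0..} \<Longrightarrow> dist t T < d \<Longrightarrow> dist (y t) (y T) < y T"
    using assms unfolding continuous_on_iff by (meson atLeast_iff)
  then show thesis
    using assms(2) by (intro that[of d]) (force simp: dist_real_def abs_less_iff)+
qed

text \<open>\<open>\<alpha>\<close> is the initial slope. For \<open>\<alpha> = A\<close> the slope remains so large on \<open>[0, 1]\<close> that the second
  derivative reaches 0 before the slope does.\<close>

locale shooting =
  fixes m \<gamma> :: real and A \<kappa> :: real and B :: "real \<Rightarrow> real" and x p q :: "real \<Rightarrow> real \<Rightarrow> real"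
  defines "A \<equiv> exp ((m + 2) * \<bar>\<gamma>\<bar>) + (1 + (m + 2) * \<bar>\<gamma>\<bar> * exp ((m + 2) * \<bar>\<gamma>\<bar>)) / (2 * m + 1) + 1"
    and "\<kappa> \<equiv> 1 + \<bar>\<gamma>\<bar> + A + (m + 2) * \<bar>\<gamma>\<bar>"
    and "B \<equiv> \<lambda>t. \<kappa> * exp (\<kappa> * t)"
  assumes m: "- 1/2 < m" "m \<le> 1"
    and init: "x \<alpha> 0 = - \<gamma>" "p \<alpha> 0 = \<alpha>" "q \<alpha> 0 = - 1"
    and dx: "t \<ge> 0 \<Longrightarrow> (x \<alpha> has_real_derivative p \<alpha> t) (at t within {0..})"
    and dp: "t \<ge> 0 \<Longrightarrow> (p \<alpha> has_real_derivative q \<alpha> t) (at t within {0..})"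
    and dq_cut: "t \<ge> 0 \<Longrightarrow> (q \<alpha> has_real_derivative (2 * m + 1) * (cut (B t) (p \<alpha> t))\<^sup>2 - (m + 2) * cut (B t) (x \<alpha> t) * cut (B t) (q \<alpha> t)) (at t within {0..})"
    and lip: "t \<ge> 0 \<Longrightarrow> \<bar>p \<alpha> t - p \<beta> t\<bar> \<le> 2 * exp (28 * exp (\<kappa> * t)) * \<bar>\<alpha> - \<beta>\<bar>"
      "t \<ge> 0 \<Longrightarrow> \<bar>q \<alpha> t - q \<beta> t\<bar> \<le> 2 * exp (28 * exp (\<kappa> * t)) * \<bar>\<alpha> - \<beta>\<bar>"
begin

section \<open>A priori bounds during the concave phase\<close>

lemma A_pos: "1 \<le> A"
  using m by (auto simp: A_def intro!: add_nonneg_nonneg divide_nonneg_pos mult_nonneg_nonneg)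

lemma kappa_ge: "1 \<le> \<kappa>" "A \<le> \<kappa>" "\<bar>\<gamma>\<bar> \<le> \<kappa>" "(m + 2) * \<bar>\<gamma>\<bar> \<le> \<kappa>"
proof -
  have "0 \<le> (m + 2) * \<bar>\<gamma>\<bar>" using m by simp
  then show "1 \<le> \<kappa>" "A \<le> \<kappa>" "\<bar>\<gamma>\<bar> \<le> \<kappa>" "(m + 2) * \<bar>\<gamma>\<bar> \<le> \<kappa>"
    using A_pos unfolding \<kappa>_def by linarith+
qed

lemma B_ge:
  assumes "t \<ge> 0"
  shows "\<kappa> + \<kappa> * t \<le> B t" "exp (\<kappa> * t) \<le> B t"
proof -
  have "\<kappa> * (1 + \<kappa> * t) \<le> B t"
    unfolding B_def using kappa_ge(1) by (intro mult_left_mono exp_ge_add_one_self_aux) (auto simp: assms intro: exp_ge_add_one_self)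
  moreover have "\<kappa> * (1 * t) \<le> \<kappa> * (\<kappa> * t)"
    using kappa_ge(1) assms by (intro mult_left_mono mult_right_mono) auto
  ultimately show "\<kappa> + \<kappa> * t \<le> B t" by (simp add: distrib_left)
  show "exp (\<kappa> * t) \<le> B t"
    unfolding B_def using mult_right_mono[OF kappa_ge(1), of "exp (\<kappa> * t)"] by simp
qed

lemma continuous: "continuous_on {0..} (x \<alpha>)" "continuous_on {0..} (p \<alpha>)" "continuous_on {0..} (q \<alpha>)"
  by (rule DERIV_continuous_on, erule dx[OF atLeast_iff[THEN iffD1]] dp[OF atLeast_iff[THEN iffD1]] dq_cut[OF atLeast_iff[THEN iffD1]])+

text \<open>\<open>\<kappa>\<close> dominates \<open>|\<gamma>|\<close>, \<open>A\<close> and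
  \<open>(m + 2) * |\<gamma>|\<close>, so the bounds on \<open>x\<close>, \<open>p\<close> and
  \<open>q\<close> that concavity supplies all stay below \<open>B\<close>. The cut-off is then
  inactive and the original equation holds.\<close>

lemma concave_phase:
  assumes \<alpha>: "\<alpha> \<le> A" and T: "0 \<le> T"
    and concave: "\<And>s. s \<in> {0..T} \<Longrightarrow> 0 \<le> p \<alpha> s" "\<And>s. s \<in> {0..T} \<Longrightarrow> q \<alpha> s \<le> 0"
  shows "p \<alpha> T \<le> \<alpha>" "- \<bar>\<gamma>\<bar> \<le> x \<alpha> T" "- exp ((m + 2) * \<bar>\<gamma>\<bar> * T) \<le> q \<alpha> T"
    "(q \<alpha> has_real_derivative (2 * m + 1) * (p \<alpha> T)\<^sup>2 - (m + 2) * x \<alpha> T * q \<alpha> T) (at T within {0..})"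
proof -
  have sub: "{0..s} \<subseteq> {0..}" for s :: real by auto
  have p_le: "p \<alpha> s \<le> \<alpha>" if s: "s \<in> {0..T}" for s
  proof -
    have "- p \<alpha> 0 + 0 * (s - 0) \<le> - p \<alpha> s"
      by (rule deriv_lower_bound[where y'="\<lambda>s. - q \<alpha> s", OF _ sub]) (use s concave(2) in \<open>auto intro!: DERIV_minus dp\<close>)
    then show ?thesis by (simp add: init)
  qed
  have x_ge: "- \<bar>\<gamma>\<bar> \<le> x \<alpha> s" if s: "s \<in> {0..T}" for s
  proof -
    have "x \<alpha> 0 + 0 * (s - 0) \<le> x \<alpha> s"
      by (rule deriv_lower_bound[where y'="p \<alpha>", OF _ sub]) (use s concave(1) in \<open>auto intro!: dx\<close>)
    then show ?thesis by (simp add: init)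
  qed
  have x_abs: "\<bar>x \<alpha> s\<bar> \<le> B s" if s: "s \<in> {0..T}" for s
  proof -
    have "- x \<alpha> 0 + (- A) * (s - 0) \<le> - x \<alpha> s"
    proof (rule deriv_lower_bound[where y'="\<lambda>s. - p \<alpha> s", OF _ sub])
      show "- A \<le> - p \<alpha> r" if "r \<in> {0..s}" for r using p_le[of r] that s \<alpha> by simp
    qed (use s in \<open>auto intro!: DERIV_minus dx\<close>)
    then have "x \<alpha> s \<le> \<bar>\<gamma>\<bar> + A * s" using init(1) by (simp add: abs_if split: if_splits)
    moreover have "A * s \<le> \<kappa> * s" using s kappa_ge(2) by (intro mult_right_mono) auto
    moreover have "0 \<le> \<kappa> * s" using kappa_ge(1) s by simp
    moreover have "\<kappa> + \<kappa> * s \<le> B s" using B_ge(1)[of s] s by simp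
    ultimately show ?thesis using x_ge[OF s] kappa_ge(3) by (intro abs_leI) linarith+
  qed
  have p_abs: "\<bar>p \<alpha> s\<bar> \<le> B s" if s: "s \<in> {0..T}" for s
  proof -
    have "0 \<le> \<kappa> * s" using kappa_ge(1) s by simp
    moreover have "\<kappa> + \<kappa> * s \<le> B s" using B_ge(1)[of s] s by simp
    ultimately show ?thesis using p_le[OF s] concave(1)[OF s] \<alpha> kappa_ge(2) by linarith
  qed
  have q_ge: "- exp ((m + 2) * \<bar>\<gamma>\<bar> * s) \<le> q \<alpha> s" if s: "s \<in> {0..T}" for s
  proof -
    let ?a = "(m + 2) * \<bar>\<gamma>\<bar>"
    have "0 \<le> q \<alpha> s + exp (?a * s)"
    proof (rule linear_diff_ineq(1)[where y="\<lambda>s. q \<alpha> s + exp (?a * s)" and k="\<lambda>_. ?a", OF _ sub])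
      fix r assume r: "r \<in> {0..s}"
      then have r': "r \<in> {0..T}" using s by auto
      let ?q' = "(2 * m + 1) * (cut (B r) (p \<alpha> r))\<^sup>2 - (m + 2) * cut (B r) (x \<alpha> r) * cut (B r) (q \<alpha> r)"
      show "((\<lambda>s. q \<alpha> s + exp (?a * s)) has_real_derivative ?q' + ?a * exp (?a * r)) (at r within {0..})"
        using r by (intro DERIV_add dq_cut) (auto intro!: derivative_eq_intros)
      have B0: "0 \<le> B r" using x_abs[OF r'] by linarith
      \<comment> \<open>It is not yet known here that the cut-off leaves \<open>q\<close> unchanged.
        Clipping a nonpositive number can only raise it, which is harmless for a lower
        bound.\<close>
      have c: "q \<alpha> r \<le> cut (B r) (q \<alpha> r)" "cut (B r) (q \<alpha> r) \<le> 0"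
        using concave(2)[OF r'] B0 by (auto simp: cut_def)
      have "0 \<le> (x \<alpha> r + \<bar>\<gamma>\<bar>) * (- cut (B r) (q \<alpha> r))"
        using c x_ge[OF r'] by (intro mult_nonneg_nonneg) auto
      moreover have "\<bar>\<gamma>\<bar> * q \<alpha> r \<le> \<bar>\<gamma>\<bar> * cut (B r) (q \<alpha> r)" using c by (intro mult_left_mono) auto
      ultimately have "\<bar>\<gamma>\<bar> * q \<alpha> r \<le> - (x \<alpha> r * cut (B r) (q \<alpha> r))" by (simp add: algebra_simps)
      then have "(m + 2) * (\<bar>\<gamma>\<bar> * q \<alpha> r) \<le> (m + 2) * (- (x \<alpha> r * cut (B r) (q \<alpha> r)))"
        using m by (intro mult_left_mono) auto
      moreover have "0 \<le> (2 * m + 1) * (cut (B r) (p \<alpha> r))\<^sup>2" using m by simp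
      ultimately show "?a * (q \<alpha> r + exp (?a * r)) \<le> ?q' + ?a * exp (?a * r)"
        unfolding cut_eq[OF x_abs[OF r']] by (simp add: algebra_simps)
    qed (use s in \<open>auto simp: init\<close>)
    then show ?thesis by simp
  qed
  have q_abs: "\<bar>q \<alpha> T\<bar> \<le> B T"
  proof -
    have "(m + 2) * \<bar>\<gamma>\<bar> * T \<le> \<kappa> * T" using T kappa_ge(4) by (intro mult_right_mono)
    then have "exp ((m + 2) * \<bar>\<gamma>\<bar> * T) \<le> B T" using B_ge(2)[OF T] by (meson exp_le_cancel_iff order_trans)
    then show ?thesis using q_ge[of T] concave(2)[of T] T by simp
  qed
  show "p \<alpha> T \<le> \<alpha>" "- \<bar>\<gamma>\<bar> \<le> x \<alpha> T" "- exp ((m + 2) * \<bar>\<gamma>\<bar> * T) \<le> q \<alpha> T"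
    using p_le x_ge q_ge T by auto
  show "(q \<alpha> has_real_derivative (2 * m + 1) * (p \<alpha> T)\<^sup>2 - (m + 2) * x \<alpha> T * q \<alpha> T) (at T within {0..})"
    using dq_cut[OF T, of \<alpha>] cut_eq[OF x_abs[of T]] cut_eq[OF p_abs[of T]] cut_eq[OF q_abs] T by simp
qed

section \<open>The two shooting sets and an intermediate slope\<close>

definition "turns_down = {\<alpha>. \<exists>t\<ge>0. 0 < - p \<alpha> t \<and> (\<forall>s\<in>{0..t}. 0 < - q \<alpha> s)}"
definition "turns_convex = {\<alpha>. \<exists>t\<ge>0. 0 < q \<alpha> t \<and> (\<forall>s\<in>{0..t}. 0 < p \<alpha> s)}"

lemma open_turns: "open turns_down" "open turns_convex"
proof -
  have M: "0 \<le> s \<Longrightarrow> s \<le> t \<Longrightarrow> 2 * exp (28 * exp (\<kappa> * s)) \<le> 2 * exp (28 * exp (\<kappa> * t))"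
    "0 < 2 * exp (28 * exp (\<kappa> * t))" for s t
    using kappa_ge(1) by (auto intro!: mult_left_mono)
  show "open turns_down"
    unfolding turns_down_def
    by (rule open_shooting_set[where M="\<lambda>t. 2 * exp (28 * exp (\<kappa> * t))"])
      (use lip M continuous in \<open>auto intro!: continuous_intros simp: abs_minus_commute\<close>)
  show "open turns_convex"
    unfolding turns_convex_def
    by (rule open_shooting_set[where M="\<lambda>t. 2 * exp (28 * exp (\<kappa> * t))"]) (use lip M continuous in auto)
qed

lemma turns_disjoint: "turns_down \<inter> turns_convex = {}"
proof -
  have False if "0 \<le> t1" "0 < - p \<alpha> t1" "\<forall>s\<in>{0..t1}. 0 < - q \<alpha> s" "0 \<le> t2" "0 < q \<alpha> t2" "\<forall>s\<in>{0..t2}. 0 < p \<alpha> s" for \<alpha> t1 t2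
    using that(1,2,4,5) bspec[OF that(3), of t2] bspec[OF that(6), of t1] by (cases "t1 \<le> t2") auto
  then show ?thesis unfolding turns_down_def turns_convex_def by blast
qed

lemma zero_turns_down: "0 \<in> turns_down"
proof -
  have "continuous_on {0..} (\<lambda>t. - q 0 t)" by (intro continuous_intros continuous)
  moreover have "0 < - q 0 0" by (simp add: init)
  ultimately obtain d where d: "0 < d" "\<And>t. 0 \<le> t \<Longrightarrow> t < 0 + d \<Longrightarrow> 0 < - q 0 t"
    using persist_pos[OF _ order_refl] by blast
  have "((\<lambda>t. - p 0 t) has_real_derivative 1) (at 0 within {0..})"
    using DERIV_minus[OF dp[of 0 0]] by (simp add: init)
  then obtain e where e: "0 < e" "\<And>h. 0 < h \<Longrightarrow> 0 + h \<in> {0..} \<Longrightarrow> h < e \<Longrightarrow> - p 0 0 < - p 0 (0 + h)"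
    using has_real_derivative_pos_inc_right[of "\<lambda>t. - p 0 t" 1 0 "{0..}"] by auto
  define t where "t = min d e / 2"
  have "0 < t" "t < d" "t < e" using d(1) e(1) by (auto simp: t_def min_def)
  then show ?thesis
    unfolding turns_down_def using e(2)[of t] d(2) by (auto intro!: exI[of _ t] simp: init)
qed

text \<open>While the orbit is concave with nonnegative slope, on \<open>[0, 1]\<close> one has
  \<open>q \<ge> - exp a\<close>, hence \<open>p \<ge> A - exp a = P\<close>. With
  \<open>P \<ge> 1\<close> this gives \<open>q' \<ge> (2 * m + 1) * P - a * exp a \<ge> 1\<close>,
  so \<open>q\<close> climbs from -1 to 0 by time 1. The summands of \<open>A\<close> pay for these
  two estimates.\<close>

lemma A_not_turns_down: "A \<notin> turns_down"
proof
  assume "A \<in> turns_down"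
  then obtain t where t: "t \<ge> 0" "p A t < 0" and q: "\<And>s. s \<in> {0..t} \<Longrightarrow> q A s < 0"
    unfolding turns_down_def by auto
  have "continuous_on {0..t} (p A)" by (rule continuous_on_subset[OF continuous(2)]) auto
  from first_zero[OF this t(1)] t(2) A_pos
  obtain T where T: "0 < T" "T \<le> t" "p A T = 0" and p: "\<And>s. 0 \<le> s \<Longrightarrow> s < T \<Longrightarrow> 0 < p A s"
    by (auto simp: init)
  define a where "a = (m + 2) * \<bar>\<gamma>\<bar>"
  define P where "P = (1 + a * exp a) / (2 * m + 1) + 1"
  have a: "0 \<le> a" using m by (simp add: a_def)
  have P: "1 \<le> P" using a m by (simp add: P_def)
  have A: "A = exp a + P" by (simp add: A_def P_def a_def)
  have p0: "0 \<le> p A s" if "s \<in> {0..T}" for s using p[of s] T(3) that by (cases "s = T") auto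
  have phase: "- \<bar>\<gamma>\<bar> \<le> x A s" "- exp (a * s) \<le> q A s"
    "(q A has_real_derivative (2 * m + 1) * (p A s)\<^sup>2 - (m + 2) * x A s * q A s) (at s within {0..})" if "s \<in> {0..T}" for s
    using concave_phase[of A s] p0 less_imp_le[OF q] that T(2) unfolding a_def by auto
  have q_ge: "- exp a \<le> q A s" if s: "s \<in> {0..T}" "s \<le> 1" for s
  proof -
    have "a * s \<le> a * 1" using s a by (intro mult_left_mono) auto
    then have "exp (a * s) \<le> exp a" by simp
    then show ?thesis using phase(2)[OF s(1)] by linarith
  qed
  have p_ge: "P \<le> p A s" if s: "s \<in> {0..T}" "s \<le> 1" for s
  proof -
    have "p A 0 + (- exp a) * (s - 0) \<le> p A s"
      by (rule deriv_lower_bound[where S="{0..}" and y'="q A"]) (use s q_ge in \<open>auto intro!: dp\<close>)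
    then have "p A 0 - exp a * s \<le> p A s" by simp
    moreover have "exp a * s \<le> exp a * 1" using s by (intro mult_left_mono) auto
    moreover have "p A 0 = exp a + P" using init(2)[of A] A by linarith
    ultimately show ?thesis by linarith
  qed
  have T1: "1 < T"
  proof (rule ccontr)
    assume "\<not> ?thesis"
    then show False using p_ge[of T] T P by simp
  qed
  have "q A 0 + 1 * (1 - 0) \<le> q A 1"
  proof (rule deriv_lower_bound[where S="{0..}"])
    fix s :: real assume "s \<in> {0..1}"
    then have s: "s \<in> {0..T}" "s \<le> 1" using T1 by auto
    show "(q A has_real_derivative (2 * m + 1) * (p A s)\<^sup>2 - (m + 2) * x A s * q A s) (at s within {0..})"
      by (rule phase(3)[OF s(1)])
    have "P * 1 \<le> (p A s) * (p A s)" using p_ge[OF s] P by (intro mult_mono) auto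
    then have "(2 * m + 1) * P \<le> (2 * m + 1) * (p A s)\<^sup>2" using m by (intro mult_left_mono) (auto simp: power2_eq_square)
    moreover have "(2 * m + 1) * P = 1 + a * exp a + (2 * m + 1)" using m by (simp add: P_def field_simps)
    moreover have "- (a * exp a) \<le> - ((m + 2) * x A s * q A s)"
    proof -
      have q': "0 \<le> - q A s" using q[of s] s T(2) by simp
      have "(- x A s) * (- q A s) \<le> \<bar>\<gamma>\<bar> * exp a"
        using phase(1)[OF s(1)] q_ge[OF s] q' mult_mono[of "- x A s" "\<bar>\<gamma>\<bar>" "- q A s" "exp a"] by simp
      then have "(m + 2) * ((- x A s) * (- q A s)) \<le> (m + 2) * (\<bar>\<gamma>\<bar> * exp a)" using m by (intro mult_left_mono) auto
      then show ?thesis by (simp add: a_def mult.assoc)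
    qed
    ultimately show "1 \<le> (2 * m + 1) * (p A s)\<^sup>2 - (m + 2) * x A s * q A s" using m by linarith
  qed auto
  then show False using q[of 1] T1 T(2) by (simp add: init)
qed

text \<open>At a first zero of \<open>p\<close> or \<open>q\<close> only one of them vanishes, and
  the equation makes the crossing strict: \<open>p' = q < 0\<close> would put
  \<open>\<alpha>\<close> into \<open>turns_down\<close>, and
  \<open>q' = (2 * m + 1) * p^2 > 0\<close> into \<open>turns_convex\<close>.\<close>

lemma between_concave:
  assumes \<alpha>: "0 \<le> \<alpha>" "\<alpha> \<le> A" "\<alpha> \<notin> turns_down" "\<alpha> \<notin> turns_convex" and t: "t \<ge> 0"
  shows "0 < p \<alpha> t \<and> q \<alpha> t < 0"
proof (rule ccontr)
  assume nb: "\<not> ?thesis"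
  have "0 < \<alpha>" using \<alpha> zero_turns_down by (cases "\<alpha> = 0") auto
  then have "0 < min (p \<alpha> 0) (- q \<alpha> 0)" "min (p \<alpha> t) (- q \<alpha> t) \<le> 0" using nb by (auto simp: init)
  moreover have "continuous_on {0..t} (\<lambda>t. min (p \<alpha> t) (- q \<alpha> t))"
    by (intro continuous_intros continuous_on_subset[OF continuous(2)] continuous_on_subset[OF continuous(3)]) auto
  ultimately obtain T where T: "0 < T" "min (p \<alpha> T) (- q \<alpha> T) = 0" and pos: "\<And>s. 0 \<le> s \<Longrightarrow> s < T \<Longrightarrow> 0 < min (p \<alpha> s) (- q \<alpha> s)"
    using first_zero[of 0 t "\<lambda>t. min (p \<alpha> t) (- q \<alpha> t)"] t by metis
  have T0: "0 \<le> p \<alpha> T" "q \<alpha> T \<le> 0" using T(2) by (auto simp: min_def split: if_splits)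
  have pq: "0 \<le> p \<alpha> s" "q \<alpha> s \<le> 0" if "s \<in> {0..T}" for s
    using pos[of s] T0 that by (cases "s = T"; auto)+
  have dq: "(q \<alpha> has_real_derivative (2 * m + 1) * (p \<alpha> s)\<^sup>2 - (m + 2) * x \<alpha> s * q \<alpha> s) (at s within {0..})" if "s \<in> {0..T}" for s
    using concave_phase(4)[of \<alpha> s] pq that \<alpha> by auto
  have "continuous_on {0..T} (x \<alpha>)" by (rule continuous_on_subset[OF continuous(1)]) auto
  then have nz: "0 < (p \<alpha> T)\<^sup>2 + (q \<alpha> T)\<^sup>2"
  proof (rule flow_not_both_zero[OF m(1) less_imp_le[OF T(1)] _ _ dq])
    show "(p \<alpha> has_real_derivative q \<alpha> s) (at s within {0..})" if "s \<in> {0..T}" for s using dp that by simp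
    show "0 < (p \<alpha> 0)\<^sup>2 + (q \<alpha> 0)\<^sup>2" by (simp add: init add_nonneg_pos)
  qed  have cq: "continuous_on {0..} (\<lambda>t. - q \<alpha> t)" by (intro continuous_intros continuous)
  consider (down) "p \<alpha> T = 0" "q \<alpha> T < 0" | (convex) "q \<alpha> T = 0" "0 < p \<alpha> T"
    using T(2) T0 nz by (cases "p \<alpha> T = 0"; cases "q \<alpha> T = 0") (auto simp: min_def split: if_splits)
  then show False
  proof cases
    case down
    have "0 \<le> T" "0 < - q \<alpha> T" using down T by auto
    from persist_pos[OF cq this] obtain d where d: "0 < d" "\<And>t. T \<le> t \<Longrightarrow> t < T + d \<Longrightarrow> 0 < - q \<alpha> t"
      by blast
    have "((\<lambda>t. - p \<alpha> t) has_real_derivative - q \<alpha> T) (at T within {0..})"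
      using T by (intro DERIV_minus dp) auto
    then obtain e where e: "0 < e" "\<And>h. 0 < h \<Longrightarrow> T + h \<in> {0..} \<Longrightarrow> h < e \<Longrightarrow> - p \<alpha> T < - p \<alpha> (T + h)"
      using has_real_derivative_pos_inc_right[of "\<lambda>t. - p \<alpha> t" "- q \<alpha> T" T "{0..}"] down by auto
    define h where "h = min d e / 2"
    have h: "0 < h" "h < d" "h < e" using d(1) e(1) by (auto simp: h_def min_def)
    have "0 < - q \<alpha> s" if "s \<in> {0..T + h}" for s
      using pos[of s] d(2)[of s] that h by (cases "s < T") auto
    moreover have "0 < - p \<alpha> (T + h)" using e(2)[of h] h T down by simp
    ultimately have "\<alpha> \<in> turns_down" unfolding turns_down_def using T h by (auto intro!: exI[of _ "T + h"])
    then show False using \<alpha> by simp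
  next
    case convex
    have "0 \<le> T" using T by simp
    from persist_pos[OF continuous(2) this convex(2)] obtain d where d: "0 < d" "\<And>t. T \<le> t \<Longrightarrow> t < T + d \<Longrightarrow> 0 < p \<alpha> t"
      by blast
    have "(q \<alpha> has_real_derivative (2 * m + 1) * (p \<alpha> T)\<^sup>2) (at T within {0..})"
      using dq[of T] T convex by simp
    moreover have "0 < (2 * m + 1) * (p \<alpha> T)\<^sup>2" using convex m by simp
    ultimately obtain e where e: "0 < e" "\<And>h. 0 < h \<Longrightarrow> T + h \<in> {0..} \<Longrightarrow> h < e \<Longrightarrow> q \<alpha> T < q \<alpha> (T + h)"
      using has_real_derivative_pos_inc_right[of "q \<alpha>" _ T "{0..}"] by blast
    define h where "h = min d e / 2"
    have h: "0 < h" "h < d" "h < e" using d(1) e(1) by (auto simp: h_def min_def)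
    have "0 < p \<alpha> s" if "s \<in> {0..T + h}" for s
      using pos[of s] d(2)[of s] that h by (cases "s < T") auto
    moreover have "0 < q \<alpha> (T + h)" using e(2)[of h] h T convex by simp
    ultimately have "\<alpha> \<in> turns_convex" unfolding turns_convex_def using T h by (auto intro!: exI[of _ "T + h"])
    then show False using \<alpha> by simp
  qed
qed

lemma exists_flow: "\<exists>\<alpha>. similarity_flow m (x \<alpha>) (p \<alpha>) (q \<alpha>)"
proof -
  have "\<not> {0..A} \<subseteq> turns_down \<union> turns_convex"
  proof
    assume c: "{0..A} \<subseteq> turns_down \<union> turns_convex"
    then have "turns_down \<inter> {0..A} = {} \<or> turns_convex \<inter> {0..A} = {}"
      using connectedD[OF connected_Icc open_turns, of 0 A] turns_disjoint by blast
    moreover have "0 \<in> {0..A}" "A \<in> {0..A}" using A_pos by auto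
    ultimately show False using zero_turns_down A_not_turns_down c by blast
  qed
  then obtain \<alpha> where "\<alpha> \<in> {0..A}" "\<alpha> \<notin> turns_down" "\<alpha> \<notin> turns_convex" by blast
  then have \<alpha>: "0 \<le> \<alpha>" "\<alpha> \<le> A" "\<alpha> \<notin> turns_down" "\<alpha> \<notin> turns_convex" by simp_all
  have pq: "0 < p \<alpha> t" "q \<alpha> t < 0" if "t \<ge> 0" for t using between_concave[OF \<alpha> that] by auto
  have dq: "(q \<alpha> has_real_derivative (2 * m + 1) * (p \<alpha> t)\<^sup>2 - (m + 2) * x \<alpha> t * q \<alpha> t) (at t within {0..})" if "t \<ge> 0" for t
    using concave_phase(4)[OF \<alpha>(2) that] pq by (simp add: less_imp_le)
  have p_mono: "p \<alpha> t \<le> p \<alpha> s" if "0 \<le> s" "s \<le> t" for s t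
  proof -
    have "- p \<alpha> s + 0 * (t - s) \<le> - p \<alpha> t"
      by (rule deriv_lower_bound[where S="{0..}" and y'="\<lambda>t. - q \<alpha> t"]) (use that less_imp_le[OF pq(2)] in \<open>auto intro!: DERIV_minus dp\<close>)
    then show ?thesis by simp
  qed
  have small: "\<exists>T\<ge>0. p \<alpha> T < e" if e: "e > 0" for e
  proof (rule ccontr)
    assume "\<not> ?thesis"
    then have pe: "e \<le> p \<alpha> t" if "t \<ge> 0" for t using that by force
    \<comment> \<open>By this time a slope of at least \<open>e\<close> has made \<open>x\<close>
      nonnegative. From then on \<open>q' \<ge> (2 * m + 1) * e^2\<close>, which brings
      \<open>q\<close> up to 0 in finite time.\<close>
    define T where "T = \<bar>\<gamma>\<bar> / e"
    have T: "T \<ge> 0" using e by (simp add: T_def)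
    have x0: "0 \<le> x \<alpha> t" if t: "t \<ge> T" for t
    proof -
      have "x \<alpha> 0 + e * (t - 0) \<le> x \<alpha> t"
        by (rule deriv_lower_bound[where S="{0..}" and y'="p \<alpha>"]) (use t T pe in \<open>auto intro!: dx\<close>)
      moreover have "e * T \<le> e * t" using t e by (intro mult_left_mono) auto
      moreover have "e * T = \<bar>\<gamma>\<bar>" using e by (simp add: T_def)
      ultimately show ?thesis by (simp add: init)
    qed
    define c where "c = (2 * m + 1) * e\<^sup>2"
    have c: "0 < c" using m e by (simp add: c_def)
    define t where "t = T - q \<alpha> T / c"
    have t: "T \<le> t" using pq(2)[OF T] c by (simp add: t_def divide_le_0_iff)
    have "q \<alpha> T + c * (t - T) \<le> q \<alpha> t"
    proof (rule deriv_lower_bound[where S="{0..}", OF t])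
      fix s assume s: "s \<in> {T..t}"
      then have s0: "s \<ge> 0" using T by simp
      show "(q \<alpha> has_real_derivative (2 * m + 1) * (p \<alpha> s)\<^sup>2 - (m + 2) * x \<alpha> s * q \<alpha> s) (at s within {0..})"
        by (rule dq[OF s0])
      have "e\<^sup>2 \<le> (p \<alpha> s)\<^sup>2" using pe[OF s0] e by (intro power_mono) auto
      then have "c \<le> (2 * m + 1) * (p \<alpha> s)\<^sup>2" unfolding c_def using m by (intro mult_left_mono) auto
      moreover have "(m + 2) * x \<alpha> s * q \<alpha> s \<le> 0"
        using x0[of s] s pq(2)[OF s0] m by (simp add: mult_nonneg_nonpos)
      ultimately show "c \<le> (2 * m + 1) * (p \<alpha> s)\<^sup>2 - (m + 2) * x \<alpha> s * q \<alpha> s" by linarith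
    qed (use T in auto)
    then show False using pq(2)[of t] t T c by (simp add: t_def)
  qed
  have "(p \<alpha> \<longlongrightarrow> 0) at_top"
  proof (rule order_tendstoI)
    fix e :: real
    show "\<forall>\<^sub>F t in at_top. e < p \<alpha> t" if "e < 0"
      using eventually_ge_at_top[of 0] by eventually_elim (use pq(1) that in force)
    assume "0 < e"
    then obtain T where T: "T \<ge> 0" "p \<alpha> T < e" using small by blast
    show "\<forall>\<^sub>F t in at_top. p \<alpha> t < e"
      using eventually_ge_at_top[of T] by eventually_elim (use p_mono[OF T(1)] T(2) in force)
  qed
  then have "similarity_flow m (x \<alpha>) (p \<alpha>) (q \<alpha>)"
    using m dx dp dq init by unfold_locales auto
  then show ?thesis by blast
qed

end

section \<open>Return to the boundary value problem\<close>

lemma bvp_solution_iff_similarity_flow: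
  assumes "- 1/2 < m" "m \<le> 1"
  shows "bvp_solution m \<gamma> f \<longleftrightarrow> (\<exists>u q. similarity_flow m f u q \<and> f 0 = - \<gamma> \<and> q 0 = - 1)"
proof
  assume "bvp_solution m \<gamma> f"
  then obtain u q r where d: "\<And>t. t \<ge> 0 \<Longrightarrow> (f has_real_derivative u t) (at t within {0..})"
      "\<And>t. t \<ge> 0 \<Longrightarrow> (u has_real_derivative q t) (at t within {0..})"
      "\<And>t. t \<ge> 0 \<Longrightarrow> (q has_real_derivative r t) (at t within {0..})"
    and ode: "\<And>t. t \<ge> 0 \<Longrightarrow> r t + (m + 2) * f t * q t - (2 * m + 1) * (u t)\<^sup>2 = 0"
    and bc: "f 0 = - \<gamma>" "q 0 = - 1" "(u \<longlongrightarrow> 0) at_top"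
    unfolding bvp_solution_def by (metis atLeast_iff)
  have "r t = (2 * m + 1) * (u t)\<^sup>2 - (m + 2) * f t * q t" if "t \<ge> 0" for t using ode[OF that] by linarith
  then have "similarity_flow m f u q"
    using assms d bc by unfold_locales (auto dest: d(3))
  then show "\<exists>u q. similarity_flow m f u q \<and> f 0 = - \<gamma> \<and> q 0 = - 1" using bc by blast
next
  assume "\<exists>u q. similarity_flow m f u q \<and> f 0 = - \<gamma> \<and> q 0 = - 1"
  then obtain u q where F: "similarity_flow m f u q" and init: "f 0 = - \<gamma>" "q 0 = - 1" by blast
  interpret similarity_flow m f u q by fact
  show "bvp_solution m \<gamma> f"
    unfolding bvp_solution_def
    by (rule exI[of _ u], rule exI[of _ q], rule exI[of _ "\<lambda>t. (2 * m + 1) * (u t)\<^sup>2 - (m + 2) * f t * q t"])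
      (use df du dq init u_lim in auto)
qed

theorem theorem3p7:
  fixes m \<gamma> :: real
  assumes "m \<in> {-1/2<..1}"
  shows "\<exists>f. bvp_solution m \<gamma> f \<and> concave_on {0..} f \<and>
             (\<forall>g. bvp_solution m \<gamma> g \<longrightarrow> (\<forall>t\<in>{0..}. g t = f t))"
proof -
  have m: "- 1/2 < m" "m \<le> 1" using assms by auto
  define A where "A = exp ((m + 2) * \<bar>\<gamma>\<bar>) + (1 + (m + 2) * \<bar>\<gamma>\<bar> * exp ((m + 2) * \<bar>\<gamma>\<bar>)) / (2 * m + 1) + 1"
  define \<kappa> where "\<kappa> = 1 + \<bar>\<gamma>\<bar> + A + (m + 2) * \<bar>\<gamma>\<bar>"
  have "0 \<le> A" using m by (auto simp: A_def intro!: add_nonneg_nonneg divide_nonneg_pos mult_nonneg_nonneg)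
  then have "1 \<le> \<kappa>" using m by (simp add: \<kappa>_def)
  from truncated_flow[OF m this, of \<gamma>] obtain x p q :: "real \<Rightarrow> real \<Rightarrow> real" where
    "shooting m \<gamma> x p q"
    unfolding shooting_def A_def[symmetric] \<kappa>_def[symmetric] using m by blast
  then interpret shooting m \<gamma> A \<kappa> "\<lambda>t. \<kappa> * exp (\<kappa> * t)" x p q
    unfolding A_def \<kappa>_def .
  obtain \<alpha> where F: "similarity_flow m (x \<alpha>) (p \<alpha>) (q \<alpha>)" using exists_flow by blast
  show ?thesis
  proof (intro exI[of _ "x \<alpha>"] conjI allI impI ballI)
    show "bvp_solution m \<gamma> (x \<alpha>)"
      using bvp_solution_iff_similarity_flow[OF m] F init by blast
    show "concave_on {0..} (x \<alpha>)" by (rule similarity_flow.concave[OF F])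
    fix g t assume "bvp_solution m \<gamma> g" and "t \<in> {0::real..}"
    then obtain u w where G: "similarity_flow m g u w" "g 0 = - \<gamma>" "w 0 = - 1" and t: "t \<ge> 0"
      using bvp_solution_iff_similarity_flow[OF m] by auto
    show "g t = x \<alpha> t"
      \<comment> \<open>The comparison assumes ordered initial slopes; the two instances cover both
        orders.\<close>
      using similarity_flow_unique[OF F G(1) _ _ _ t] similarity_flow_unique[OF G(1) F _ _ _ t] G init
      by (cases "p \<alpha> 0 \<le> u 0") auto
  qed
qed

end
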